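(* Let $\succsim$ be a weak order on $F$ and $(\succsim_A)_{A\in\Sigma}$ a family of weak orders on $F$ satisfying axioms (P1½)–(P6½), and let $\mathcal{E}\subseteq\Sigma\setminus\{\varnothing\}$ be a family of events as in (SE) such that (P0½) holds (all axioms stated in the context). Then there exist a family $\{u_E\}_{E\in\mathcal{E}}$ of functions $u_E:O\to\mathbb{R}$, with each $u_E$ unique up to positive affine transformations, and a unique family $\{P_E\}_{E\in\mathcal{E}}$ of finitely additive, convex-valued probability measures on $\Sigma$, such that for each pair of acts $f$ and $g$: $f\succsim g$ if and only if for every $E\in\mathcal{E}$ with $\int u_E(g)\,dP_E>\int u_E(f)\,dP_E$ there exists $E'\in\mathcal{E}$ with $E'\supseteq E$ and $\int u_{E'}(f)\,dP_{E'}>\int u_{E'}(g)\,dP_{E'}$.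
   Context: Framework. $S$ is an infinite set (states), $\Sigma\subseteq 2^S$ is a $\sigma$-algebra (its elements are called events), $O$ is a set (outcomes). $F$ is the set of acts: functions $f:S\to O$ with finite range and $f^{-1}(o)\in\Sigma$ for every $o\in O$. A constant act is an act with constant value. A weak order is a complete and transitive binary relation; for a weak order $\succsim$, $f\succ g$ means $f\succsim g$ and not $g\succsim f$, and $f\sim g$ means $f\succsim g$ and $g\succsim f$. $\succsim$ is a weak order on $F$ and, for each event $A$ (including $\varnothing$), $\succsim_A$ is a weak order on $F$. For an event $A$ and acts $f,g$, $fAg$ is the act equal to $f$ on $A$ and to $g$ on $S\setminus A$. $\succsim_A$ agrees with $\succsim_B$ if for all acts $f,g$: $f\succsim_A g\Leftrightarrow f\succsim_B g$. For events $B\subseteq A$, $B$ is null at $A$ if $\succsim_{A\setminus B}$ agrees with $\succsim_A$; otherwise $B$ is non-null at $A$. Axioms. (P1½) For every event $A$ and acts $f,g$: $f\succsim_A g$ implies $fAh\succsim_A gAh$ for every act $h$; and $fAh\succsim_A gAh$ for some act $h$ implies $f\succsim_A g$. (P2½) For all events $B\subseteq A$ and acts $f,g$: $f\succsim_B g$ and $f\succsim_{A\setminus B}g$ imply $f\succsim_A g$; and if $B$ is non-null at $A$, then $f\succ_B g$ and $f\succsim_{A\setminus B}g$ imply $f\succ_A g$. (P3½) For every non-empty event $A$ and constant acts $f,g$: $f\succsim_A g\Leftrightarrow f\succsim_S g$. (P4½) For all events $A,B,C$ with $B,C\subseteq A$ and constant acts $f,f',g,g'$ with $f\succ_S f'$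 and $g\succ_S g'$: $fBf'\succsim_A fCf'$ implies $gBg'\succsim_A gCg'$. (P5½) There exist constant acts $f,g$ with $f\succ_S g$. (P6½) For every non-empty event $A$ and acts $f,g,h$ with $f\succ_A g$ and $h$ constant, there is a finite partition of $A$ into events $A_1,\dots,A_n$ such that for each $i$: $f\succ_A hA_ig$ and $hA_if\succ_A g$. (SE) There is a family $\mathcal{E}\subseteq\Sigma\setminus\{\varnothing\}$ such that: (a) for every $B\in\Sigma$, if $\succsim_E$ agrees with $\succsim_{E\setminus B}$ for all $E\in\mathcal{E}$ with $B\subseteq E$, then $\succsim_A$ agrees with $\succsim_{A\setminus B}$ for all $A\in\Sigma$ with $B\subseteq A$; (b) for all $A\in\Sigma$ and $E\in\mathcal{E}$ with $E\subseteq A$, either $\succsim_A$ agrees with $\succsim_{A\setminus E}$ or $\succsim_A$ agrees with $\succsim_E$. (P0½) For the family $\mathcal{E}$ of (SE) and all acts $f,g$: $f\succsim g$ if and only if for every $E\in\mathcal{E}$ with $g\succ_E f$ there is $E'\in\mathcal{E}$ with $E'\supseteq E$ and $f\succ_{E'}g$. A finitely additive probability $P$ on $\Sigma$ is convex-valued if for every event $B$ and $\lambda\in[0,1]$ there is an event $A\subseteq B$ with $P(A)=\lambda P(B)$. (A probability $P_E$ on the events contained in $E$ is identified with the probability $P_E(E\cap\cdot)$ on $\Sigma$.)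
   Formalization: Uniqueness of u_E and P_E is proved among families that also represent each conditional preference ≿_E by expected utility; from the displayed criterion for ≿ alone it fails when E⊂E′ are in the family and E is non-null at E′. *)

theory Defs
  imports "HOL-Analysis.Sigma_Algebra" "HOL-Analysis.Measure_Space" "HOL-Library.Disjoint_Sets"
begin

text \<open>
  States and outcomes are the elements of the types \<open>'s\<close> and \<open>'o\<close>; the events are the members of
  a sigma-algebra \<open>Ev\<close> on \<open>UNIV :: 's set\<close>. Conditional preferences are a family
  \<open>R :: 's set \<Rightarrow> ('s, 'o) act \<Rightarrow> ('s, 'o) act \<Rightarrow> bool\<close> indexed by events; \<open>R A f g\<close> reads
  "\<open>f\<close> is weakly preferred to \<open>g\<close> given \<open>A\<close>". Only its values on events and acts matter.
  The constant act with value \<open>x\<close> is \<open>\<lambda>_. x\<close>.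
\<close>

type_synonym ('s, 'o) act = "'s \<Rightarrow> 'o"

definition acts :: "'s set set \<Rightarrow> ('s, 'o) act set" where
  "acts Ev = {f. finite (range f) \<and> (\<forall>x. f -` {x} \<in> Ev)}"

definition weak_order_on :: "'a set \<Rightarrow> ('a \<Rightarrow> 'a \<Rightarrow> bool) \<Rightarrow> bool" where
  "weak_order_on F Q \<longleftrightarrow> (\<forall>f\<in>F. \<forall>g\<in>F. Q f g \<or> Q g f) \<and> transp_on F Q"

definition strict :: "('a \<Rightarrow> 'a \<Rightarrow> bool) \<Rightarrow> 'a \<Rightarrow> 'a \<Rightarrow> bool" where
  "strict Q f g \<longleftrightarrow> Q f g \<and> \<not> Q g f"

definition paste :: "('s, 'o) act \<Rightarrow> 's set \<Rightarrow> ('s, 'o) act \<Rightarrow> ('s, 'o) act" where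
  "paste f A g = (\<lambda>s. if s \<in> A then f s else g s)"

definition agrees :: "'s set set \<Rightarrow> (('s, 'o) act \<Rightarrow> ('s, 'o) act \<Rightarrow> bool)
    \<Rightarrow> (('s, 'o) act \<Rightarrow> ('s, 'o) act \<Rightarrow> bool) \<Rightarrow> bool" where
  "agrees Ev Q Q' \<longleftrightarrow> (\<forall>f\<in>acts Ev. \<forall>g\<in>acts Ev. Q f g \<longleftrightarrow> Q' f g)"

definition null_at :: "'s set set \<Rightarrow> ('s set \<Rightarrow> ('s, 'o) act \<Rightarrow> ('s, 'o) act \<Rightarrow> bool)
    \<Rightarrow> 's set \<Rightarrow> 's set \<Rightarrow> bool" where
  "null_at Ev R B A \<longleftrightarrow> agrees Ev (R (A - B)) (R A)"

definition P1half :: "'s set set \<Rightarrow> ('s set \<Rightarrow> ('s, 'o) act \<Rightarrow> ('s, 'o) act \<Rightarrow> bool) \<Rightarrow> bool" where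
  "P1half Ev R \<longleftrightarrow> (\<forall>A\<in>Ev. \<forall>f\<in>acts Ev. \<forall>g\<in>acts Ev.
     (R A f g \<longrightarrow> (\<forall>h\<in>acts Ev. R A (paste f A h) (paste g A h))) \<and>
     ((\<exists>h\<in>acts Ev. R A (paste f A h) (paste g A h)) \<longrightarrow> R A f g))"

definition P2half :: "'s set set \<Rightarrow> ('s set \<Rightarrow> ('s, 'o) act \<Rightarrow> ('s, 'o) act \<Rightarrow> bool) \<Rightarrow> bool" where
  "P2half Ev R \<longleftrightarrow> (\<forall>A\<in>Ev. \<forall>B\<in>Ev. B \<subseteq> A \<longrightarrow> (\<forall>f\<in>acts Ev. \<forall>g\<in>acts Ev.
     (R B f g \<and> R (A - B) f g \<longrightarrow> R A f g) \<and>
     (\<not> null_at Ev R B A \<and> strict (R B) f g \<and> R (A - B) f g \<longrightarrow> strict (R A) f g)))"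

definition P3half :: "'s set set \<Rightarrow> ('s set \<Rightarrow> ('s, 'o) act \<Rightarrow> ('s, 'o) act \<Rightarrow> bool) \<Rightarrow> bool" where
  "P3half Ev R \<longleftrightarrow> (\<forall>A\<in>Ev. A \<noteq> {} \<longrightarrow>
     (\<forall>x y. R A (\<lambda>_. x) (\<lambda>_. y) \<longleftrightarrow> R UNIV (\<lambda>_. x) (\<lambda>_. y)))"

definition P4half :: "'s set set \<Rightarrow> ('s set \<Rightarrow> ('s, 'o) act \<Rightarrow> ('s, 'o) act \<Rightarrow> bool) \<Rightarrow> bool" where
  "P4half Ev R \<longleftrightarrow> (\<forall>A\<in>Ev. \<forall>B\<in>Ev. \<forall>C\<in>Ev. B \<subseteq> A \<longrightarrow> C \<subseteq> A \<longrightarrow> (\<forall>x x' y y'.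
     strict (R UNIV) (\<lambda>_. x) (\<lambda>_. x') \<longrightarrow> strict (R UNIV) (\<lambda>_. y) (\<lambda>_. y') \<longrightarrow>
     R A (paste (\<lambda>_. x) B (\<lambda>_. x')) (paste (\<lambda>_. x) C (\<lambda>_. x')) \<longrightarrow>
     R A (paste (\<lambda>_. y) B (\<lambda>_. y')) (paste (\<lambda>_. y) C (\<lambda>_. y'))))"

definition P5half :: "('s set \<Rightarrow> ('s, 'o) act \<Rightarrow> ('s, 'o) act \<Rightarrow> bool) \<Rightarrow> bool" where
  "P5half R \<longleftrightarrow> (\<exists>x y. strict (R UNIV) (\<lambda>_. x) (\<lambda>_. y))"

text \<open>
  The cells of a \<^const>\<open>partition_on\<close> are nonempty. This is immaterial below: an empty cell
  satisfies the requirement trivially.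
\<close>

definition P6half :: "'s set set \<Rightarrow> ('s set \<Rightarrow> ('s, 'o) act \<Rightarrow> ('s, 'o) act \<Rightarrow> bool) \<Rightarrow> bool" where
  "P6half Ev R \<longleftrightarrow> (\<forall>A\<in>Ev. A \<noteq> {} \<longrightarrow> (\<forall>f\<in>acts Ev. \<forall>g\<in>acts Ev. \<forall>x. strict (R A) f g \<longrightarrow>
     (\<exists>\<P>. finite \<P> \<and> \<P> \<subseteq> Ev \<and> partition_on A \<P> \<and>
       (\<forall>C\<in>\<P>. strict (R A) f (paste (\<lambda>_. x) C g) \<and> strict (R A) (paste (\<lambda>_. x) C f) g))))"

definition SE :: "'s set set \<Rightarrow> ('s set \<Rightarrow> ('s, 'o) act \<Rightarrow> ('s, 'o) act \<Rightarrow> bool)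
    \<Rightarrow> 's set set \<Rightarrow> bool" where
  "SE Ev R \<E> \<longleftrightarrow> \<E> \<subseteq> Ev - {{}} \<and>
     (\<forall>B\<in>Ev. (\<forall>E\<in>\<E>. B \<subseteq> E \<longrightarrow> agrees Ev (R E) (R (E - B))) \<longrightarrow>
        (\<forall>A\<in>Ev. B \<subseteq> A \<longrightarrow> agrees Ev (R A) (R (A - B)))) \<and>
     (\<forall>A\<in>Ev. \<forall>E\<in>\<E>. E \<subseteq> A \<longrightarrow> agrees Ev (R A) (R (A - E)) \<or> agrees Ev (R A) (R E))"

definition P0half :: "'s set set \<Rightarrow> (('s, 'o) act \<Rightarrow> ('s, 'o) act \<Rightarrow> bool)
    \<Rightarrow> ('s set \<Rightarrow> ('s, 'o) act \<Rightarrow> ('s, 'o) act \<Rightarrow> bool) \<Rightarrow> 's set set \<Rightarrow> bool" where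
  "P0half Ev Q R \<E> \<longleftrightarrow> (\<forall>f\<in>acts Ev. \<forall>g\<in>acts Ev. Q f g \<longleftrightarrow>
     (\<forall>E\<in>\<E>. strict (R E) g f \<longrightarrow> (\<exists>E'\<in>\<E>. E \<subseteq> E' \<and> strict (R E') f g)))"

definition fa_prob :: "'s set set \<Rightarrow> ('s set \<Rightarrow> real) \<Rightarrow> bool" where
  "fa_prob Ev P \<longleftrightarrow> (\<forall>A\<in>Ev. 0 \<le> P A) \<and> P UNIV = 1 \<and> additive Ev P"

definition convex_valued :: "'s set set \<Rightarrow> ('s set \<Rightarrow> real) \<Rightarrow> bool" where
  "convex_valued Ev P \<longleftrightarrow> (\<forall>B\<in>Ev. \<forall>l\<in>{0..1}. \<exists>A\<in>Ev. A \<subseteq> B \<and> P A = l * P B)"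

text \<open>
  The integral of \<open>u \<circ> f\<close> for a finitely additive \<open>P\<close>; since acts have finite range it is a finite
  sum and no countably additive integration theory applies.
\<close>

definition exp_util :: "('o \<Rightarrow> real) \<Rightarrow> ('s set \<Rightarrow> real) \<Rightarrow> ('s, 'o) act \<Rightarrow> real" where
  "exp_util u P f = (\<Sum>x\<in>range f. u x * P (f -` {x}))"

text \<open>
  The pairs \<open>(u E, P E)\<close> are required to represent the conditional preferences \<open>R E\<close>. Uniqueness
  can only be meant relative to this: if \<open>E \<subset> E'\<close> are in the family and \<open>E\<close> is non-null at \<open>E'\<close>,
  then \<open>R E\<close> and \<open>R E'\<close> agree, and the criterion in \<open>represents\<close> below is unaffected by
  replacing \<open>u E\<close> by a constant and \<open>P E\<close> by anything.
\<close>

definition eu_family :: "'s set set \<Rightarrow> ('s set \<Rightarrow> ('s, 'o) act \<Rightarrow> ('s, 'o) act \<Rightarrow> bool)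
    \<Rightarrow> 's set set \<Rightarrow> ('s set \<Rightarrow> 'o \<Rightarrow> real) \<Rightarrow> ('s set \<Rightarrow> 's set \<Rightarrow> real) \<Rightarrow> bool" where
  "eu_family Ev R \<E> u P \<longleftrightarrow> (\<forall>E\<in>\<E>. fa_prob Ev (P E) \<and> convex_valued Ev (P E) \<and>
     (\<forall>f\<in>acts Ev. \<forall>g\<in>acts Ev.
        R E f g \<longleftrightarrow> exp_util (u E) (P E) g \<le> exp_util (u E) (P E) f))"

definition represents :: "'s set set \<Rightarrow> (('s, 'o) act \<Rightarrow> ('s, 'o) act \<Rightarrow> bool)
    \<Rightarrow> 's set set \<Rightarrow> ('s set \<Rightarrow> 'o \<Rightarrow> real) \<Rightarrow> ('s set \<Rightarrow> 's set \<Rightarrow> real) \<Rightarrow> bool" where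
  "represents Ev Q \<E> u P \<longleftrightarrow> (\<forall>f\<in>acts Ev. \<forall>g\<in>acts Ev. Q f g \<longleftrightarrow>
     (\<forall>E\<in>\<E>. exp_util (u E) (P E) g > exp_util (u E) (P E) f \<longrightarrow>
       (\<exists>E'\<in>\<E>. E' \<supseteq> E \<and> exp_util (u E') (P E') f > exp_util (u E') (P E') g)))"

end

theory Submission
  imports Defs
begin

text \<open>
  The heart of the matter is Savage's theorem, applied to one conditional preference \<open>R E\<close> at a
  time. For a nonempty event \<open>E\<close> the relation \<open>R E\<close> satisfies the sure-thing principle
  (\<open>conditional_preference_savage\<close>): if two acts agree outside \<open>B\<close>, their comparison given \<open>E\<close> is
  decided by the comparison given \<open>E \<inter> B\<close>, except when \<open>E \<inter> B\<close> is null at \<open>E\<close>, and then they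
  are indifferent whatever their common part is. The remaining postulates of Savage are \<open>P3half\<close> to
  \<open>P6half\<close> read at \<open>E\<close>. Hence each \<open>R E\<close> has an expected utility representation, whose probability
  is unique and whose utility is unique up to positive affine maps. Substituting it into
  \<open>P0half\<close> turns the criterion for \<open>Q\<close> into the one of the theorem, and the uniqueness of the family
  is the uniqueness for each of its members.

  The probability comes from the preferences between bets that pay a better or a worse outcome.
  They order the events, and by \<open>P6half\<close> the state space is covered by finitely many pieces none of
  which makes up for a given strict difference in this order. The lemma \<open>squeeze\<close> is the substitute for countable additivity: in a
  sigma-algebra an event can be pinned down between an increasing and a decreasing sequence of
  events whose differences become negligible. It yields bisection of every event, then equal
  \<open>2\<^sup>n\<close>-fold partitions of the state space, and the probability of \<open>A\<close> is the supremum of the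
  dyadic fractions \<open>k / 2\<^sup>n\<close> such that \<open>k\<close> of the \<open>2\<^sup>n\<close> pieces are together at most as likely as
  \<open>A\<close>. Used once more, \<open>squeeze\<close> shows that this probability is convex-valued.

  The utility comes from calibration against bets instead of a detour through lotteries. Fix
  outcomes \<open>x \<succ> y\<close> and let \<open>z\<close> lie between them. In every event \<open>A\<close> there is \<open>C \<subseteq> A\<close> such that
  receiving \<open>z\<close> on \<open>A\<close> is as good as receiving \<open>x\<close> on \<open>C\<close> and \<open>y\<close> on \<open>A - C\<close>. The probability
  of \<open>C\<close> is an additive function of \<open>A\<close>, and it depends only on the probability of \<open>A\<close> because
  outcomes may be exchanged between equally likely events. An additive function of this kind is
  a multiple of the probability (\<open>additive_function_linear\<close>); the factor is the utility of \<open>z\<close>.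
  Replacing the outcomes of an act one by one shows that the act is as good as a bet whose
  winning probability is its expected utility. The scales obtained from different pairs \<open>x, y\<close>
  differ by affine maps, so they combine to one utility on all outcomes.
\<close>

section \<open>Finitely additive probabilities and expected utility\<close>

lemma acts_const:
  assumes "sigma_algebra UNIV Ev"
  shows "(\<lambda>_. x) \<in> acts Ev"
proof -
  interpret sigma_algebra UNIV Ev
    by fact
  have "(\<lambda>_. x) -` {z} \<in> Ev" for z
    by (cases "x = z") (auto simp: vimage_def)
  then show ?thesis
    by (simp add: acts_def)
qed

lemma acts_paste:
  assumes "sigma_algebra UNIV Ev" and fg: "f \<in> acts Ev" "g \<in> acts Ev" "A \<in> Ev"
  shows "paste f A g \<in> acts Ev"
proof -
  interpret sigma_algebra UNIV Ev
    by fact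
  have "paste f A g -` {z} = (A \<inter> f -` {z}) \<union> (g -` {z} - A)" for z
    by (auto simp: paste_def)
  moreover have "range (paste f A g) \<subseteq> range f \<union> range g"
    by (auto simp: paste_def)
  moreover have "(A \<inter> f -` {z}) \<union> (g -` {z} - A) \<in> Ev" for z
    using fg by (intro Un Int Diff) (auto simp: acts_def)
  ultimately show ?thesis
    using fg finite_subset[of "range (paste f A g)"] by (auto simp: acts_def)
qed

locale fa_probability = sigma_algebra UNIV Ev for Ev :: "'s set set" +
  fixes P :: "'s set \<Rightarrow> real"
  assumes fa_prob: "fa_prob Ev P"
begin

lemma nonneg: "A \<in> Ev \<Longrightarrow> 0 \<le> P A"
  and UNIV_eq_1: "P UNIV = 1"
  using fa_prob by (auto simp: fa_prob_def)

lemma add: "A \<in> Ev \<Longrightarrow> B \<in> Ev \<Longrightarrow> A \<inter> B = {} \<Longrightarrow> P (A \<union> B) = P A + P B"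
  using fa_prob by (auto simp: fa_prob_def additive_def)

lemma empty_eq_0: "P {} = 0"
  using add[of "{}" "{}"] by simp

lemma diff: "A \<in> Ev \<Longrightarrow> B \<in> Ev \<Longrightarrow> B \<subseteq> A \<Longrightarrow> P (A - B) = P A - P B"
  using add[of B "A - B"] by (simp add: Diff Un_absorb1)

lemma mono: "A \<in> Ev \<Longrightarrow> B \<in> Ev \<Longrightarrow> A \<subseteq> B \<Longrightarrow> P A \<le> P B"
  using diff[of B A] nonneg[of "B - A"] by (simp add: Diff)

lemma le_1: "A \<in> Ev \<Longrightarrow> P A \<le> 1"
  using mono[of A UNIV] UNIV_eq_1 by simp

lemma compl: "A \<in> Ev \<Longrightarrow> P (- A) = 1 - P A"
  using diff[of UNIV A] UNIV_eq_1 by (simp add: Compl_eq_Diff_UNIV)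

text \<open>
  Only finite additivity is available, so the smallness of an event is tested on the cells of
  finite covers such as those that the continuity postulate provides.
\<close>

lemma null_cover:
  assumes "finite \<P>" "\<P> \<subseteq> Ev" "\<And>C. C \<in> \<P> \<Longrightarrow> P (A \<inter> C) = 0" "A \<in> Ev" "A \<subseteq> \<Union>\<P>"
  shows "P A = 0"
proof -
  have "P (A \<inter> \<Union>\<P>) = 0"
    using assms(1-3)
  proof (induction \<P>)
    case empty
    then show ?case by (simp add: empty_eq_0)
  next
    case (insert C \<P>)
    have ev: "A \<inter> C \<in> Ev" "A \<inter> \<Union>\<P> \<in> Ev"
      using insert \<open>A \<in> Ev\<close> by (auto intro!: Int finite_Union)
    have "P (A \<inter> \<Union>(insert C \<P>)) = P ((A \<inter> C) \<union> (A \<inter> \<Union>\<P> - A \<inter> C))"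
      by (rule arg_cong[where f = P]) auto
    also have "\<dots> = P (A \<inter> C) + P (A \<inter> \<Union>\<P> - A \<inter> C)"
      by (rule add) (use ev in \<open>auto intro: Diff\<close>)
    also have "\<dots> \<le> P (A \<inter> C) + P (A \<inter> \<Union>\<P>)"
      using ev by (auto intro!: mono Diff)
    also have "\<dots> = 0"
      using insert by simp
    finally have "P (A \<inter> \<Union>(insert C \<P>)) \<le> 0" .
    moreover have "A \<inter> \<Union>(insert C \<P>) \<in> Ev"
      using insert.hyps insert.prems \<open>A \<in> Ev\<close> by (intro Int finite_Union) auto
    ultimately show ?case
      using nonneg by (metis antisym)
  qed
  then show ?thesis
    using \<open>A \<subseteq> \<Union>\<P>\<close> by (simp add: inf_absorb1)
qed

lemma exp_util_superset:
  assumes "finite Z" "range f \<subseteq> Z"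
  shows "exp_util u P f = (\<Sum>z\<in>Z. u z * P (f -` {z}))"
proof -
  have "f -` {z} = {}" if "z \<notin> range f" for z
    using that by auto
  then show ?thesis
    unfolding exp_util_def using assms
    by (intro sum.mono_neutral_left) (auto simp: empty_eq_0)
qed

lemma sum_vimage:
  assumes "f \<in> acts Ev" "finite Z"
  shows "f -` Z \<in> Ev \<and> P (f -` Z) = (\<Sum>z\<in>Z. P (f -` {z}))"
  using assms(2)
proof induction
  case empty
  then show ?case by (simp add: empty_eq_0)
next
  case (insert z Z)
  have "f -` {z} \<in> Ev"
    using assms(1) by (simp add: acts_def)
  moreover have "f -` insert z Z = f -` {z} \<union> f -` Z"
    by auto
  ultimately show ?case
    using insert add[of "f -` {z}" "f -` Z"] by auto
qed

lemma exp_util_affine: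
  assumes f: "f \<in> acts Ev" and u: "\<And>z. z \<in> range f \<Longrightarrow> u' z = a * u z + b"
  shows "exp_util u' P f = a * exp_util u P f + b"
proof -
  have "finite (range f)"
    using f by (simp add: acts_def)
  moreover have "f -` range f = UNIV"
    by auto
  ultimately have one: "(\<Sum>z\<in>range f. P (f -` {z})) = 1"
    using sum_vimage[OF f, of "range f"] UNIV_eq_1 by simp
  have "exp_util u' P f = (\<Sum>z\<in>range f. a * (u z * P (f -` {z})) + b * P (f -` {z}))"
    unfolding exp_util_def by (intro sum.cong) (auto simp: u algebra_simps)
  also have "\<dots> = a * exp_util u P f + b * (\<Sum>z\<in>range f. P (f -` {z}))"
    unfolding exp_util_def by (simp add: sum.distrib sum_distrib_left)
  finally show ?thesis
    using one by simp
qed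

lemma exp_util_bet:
  assumes "A \<in> Ev"
  shows "exp_util u P (paste (\<lambda>_. x) A (\<lambda>_. y)) = u x * P A + u y * (1 - P A)"
proof (cases "x = y")
  case True
  then have "paste (\<lambda>_. x) A (\<lambda>_. y) = (\<lambda>_. x)"
    by (auto simp: paste_def)
  then show ?thesis
    using True UNIV_eq_1 by (simp add: exp_util_def algebra_simps)
next
  case False
  let ?f = "paste (\<lambda>_. x) A (\<lambda>_. y)"
  have "?f -` {x} = A" "?f -` {y} = - A" "range ?f \<subseteq> {x, y}"
    using False by (auto simp: paste_def split: if_splits)
  then show ?thesis
    using exp_util_superset[of "{x, y}" ?f u] False compl[OF assms] by simp
qed

lemma exp_util_const: "exp_util u P (\<lambda>_. x) = u x"
  using UNIV_eq_1 by (simp add: exp_util_def)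

end

locale convex_probability = fa_probability +
  assumes convex: "convex_valued Ev P"
begin

lemma subevent:
  assumes "B \<in> Ev" "0 \<le> p" "p \<le> P B"
  obtains A where "A \<in> Ev" "A \<subseteq> B" "P A = p"
proof (cases "P B = 0")
  case True
  then show ?thesis
    using that[of "{}"] assms empty_eq_0 by auto
next
  case False
  then have "P B > 0"
    using nonneg[OF \<open>B \<in> Ev\<close>] by simp
  then have "p / P B \<in> {0..1}"
    using assms by (simp add: field_simps)
  then obtain A where "A \<in> Ev" "A \<subseteq> B" "P A = p / P B * P B"
    using convex \<open>B \<in> Ev\<close> unfolding convex_valued_def by blast
  then show ?thesis
    using that False by simp
qed

text \<open>
  If \<open>U\<close> has probability \<open>1 / n\<close>, an event of probability \<open>k / n\<close> splits into \<open>k\<close> events as likely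
  as \<open>U\<close>, so \<open>m\<close> has the right values on a grid; monotonicity fills the gaps. The lemma serves
  twice: for the probability of the winning part of a calibrating bet, and for a second
  probability that represents the same preference.
\<close>

lemma additive_function_linear:
  assumes m_nonneg: "\<And>A. A \<in> Ev \<Longrightarrow> 0 \<le> m A"
    and m_add: "\<And>A B. A \<in> Ev \<Longrightarrow> B \<in> Ev \<Longrightarrow> A \<inter> B = {} \<Longrightarrow> m (A \<union> B) = m A + m B"
    and m_cong: "\<And>A B. A \<in> Ev \<Longrightarrow> B \<in> Ev \<Longrightarrow> A \<inter> B = {} \<Longrightarrow> P A = P B \<Longrightarrow> m A = m B"
    and "A \<in> Ev"
  shows "m A = m UNIV * P A"
proof -
  have eq: "m A = m B" if "A \<in> Ev" "B \<in> Ev" "P A = P B" for A B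
  proof -
    have ev: "A \<inter> B \<in> Ev" "A - B \<in> Ev" "B - A \<in> Ev"
      using that by (auto intro: Int Diff)
    have A: "A = (A \<inter> B) \<union> (A - B)" and B: "B = (A \<inter> B) \<union> (B - A)"
      by auto
    have "P A = P (A \<inter> B) + P (A - B)" "P B = P (A \<inter> B) + P (B - A)"
      using add[OF ev(1,2)] add[OF ev(1,3)] A B by auto
    then have "m (A - B) = m (B - A)"
      using that(3) ev by (intro m_cong) auto
    moreover have "m A = m (A \<inter> B) + m (A - B)" "m B = m (A \<inter> B) + m (B - A)"
      using m_add[OF ev(1,2)] m_add[OF ev(1,3)] A B by auto
    ultimately show ?thesis
      by simp
  qed
  have m0: "m {} = 0"
    using m_add[of "{}" "{}"] by simp
  have grid: "m A = m UNIV * (real k / real n)"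
    if "A \<in> Ev" "P A = real k / real n" "n > 0" for A k n
  proof -
    obtain U where U: "U \<in> Ev" "P U = 1 / real n"
      using subevent[of UNIV "1 / real n"] UNIV_eq_1 \<open>n > 0\<close> by auto
    have step: "m A = real k * m U" if "A \<in> Ev" "P A = real k / real n" for A k
      using that
    proof (induction k arbitrary: A)
      case 0
      then show ?case
        using eq[of A "{}"] empty_eq_0 m0 by simp
    next
      case (Suc k)
      have "1 / real n \<le> P A"
        using Suc.prems \<open>n > 0\<close> by (simp add: field_simps)
      then obtain B where B: "B \<in> Ev" "B \<subseteq> A" "P B = 1 / real n"
        using subevent[of A "1 / real n"] Suc.prems by auto
      have "P (A - B) = real k / real n"
        using diff[OF _ B(1,2)] Suc.prems B(3) \<open>n > 0\<close> by (simp add: field_simps)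
      then have "m (A - B) = real k * m U"
        using Suc.IH[of "A - B"] Suc.prems(1) B(1) by (simp add: Diff)
      moreover have "m B = m U"
        using eq[of B U] B U by simp
      moreover have "m A = m B + m (A - B)"
        using m_add[of B "A - B"] Suc.prems(1) B(1,2) by (simp add: Diff Un_absorb1)
      ultimately show ?case
        by (simp add: algebra_simps)
    qed
    have "m UNIV = real n * m U"
      using step[of UNIV n] UNIV_eq_1 \<open>n > 0\<close> by simp
    then show ?thesis
      using step[OF that(1,2)] \<open>n > 0\<close> by simp
  qed
  \<comment> \<open>Only the lower bound needs an approximation: applied to the complement of \<open>A\<close> it is the upper
    bound.\<close>
  have lower: "m UNIV * P A \<le> m A" if ev: "A \<in> Ev" for A
  proof (rule field_le_epsilon)
    fix e :: real
    assume "e > 0"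
    have M: "0 \<le> m UNIV"
      by (simp add: m_nonneg)
    obtain n :: nat where "max (m UNIV / e) 0 < real n"
      using reals_Archimedean2 by blast
    then have n: "m UNIV / e < real n" "n > 0"
      by auto
    define k where "k = nat \<lfloor>real n * P A\<rfloor>"
    have k: "real k \<le> real n * P A" "real n * P A \<le> real k + 1"
      using nonneg[OF ev] unfolding k_def by auto
    have "real k / real n \<le> P A"
      using k n by (simp add: field_simps)
    then obtain B where B: "B \<in> Ev" "B \<subseteq> A" "P B = real k / real n"
      using subevent[of A "real k / real n"] ev by auto
    have "m A = m B + m (A - B)"
      using m_add[of B "A - B"] ev B(1,2) by (simp add: Diff Un_absorb1)
    then have "m B \<le> m A"
      using m_nonneg[of "A - B"] ev B by (simp add: Diff)
    have "P A \<le> real k / real n + 1 / real n"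
      using k n by (simp add: field_simps)
    then have "m UNIV * P A \<le> m UNIV * (real k / real n) + m UNIV / real n"
      using mult_left_mono[OF _ M, of "P A" "real k / real n + 1 / real n"] by (simp add: distrib_left)
    also have "m UNIV / real n \<le> e"
      using n \<open>e > 0\<close> by (simp add: field_simps)
    finally show "m UNIV * P A \<le> m A + e"
      using grid[OF B(1,3) n(2)] \<open>m B \<le> m A\<close> by simp
  qed
  have cA: "- A \<in> Ev"
    using \<open>A \<in> Ev\<close> by (simp add: Compl_eq_Diff_UNIV Diff)
  have "m UNIV = m A + m (- A)"
    using m_add[of A "- A"] cA \<open>A \<in> Ev\<close> by simp
  then show ?thesis
    using lower[of A] lower[of "- A"] compl[OF \<open>A \<in> Ev\<close>] cA \<open>A \<in> Ev\<close>
    by (simp add: right_diff_distrib)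
qed

end

section \<open>Qualitative probability\<close>

text \<open>
  The relation reads "at most as likely as". By the axiom \<open>fine\<close> no cell of some finite cover is
  large enough to reverse a given strict comparison; this excludes atoms (\<open>split\<close>) and makes the
  order Archimedean (\<open>halving_small\<close>).
\<close>

locale qualitative_probability = sigma_algebra UNIV Ev for Ev :: "'s set set" +
  fixes le :: "'s set \<Rightarrow> 's set \<Rightarrow> bool" (infix "\<sqsubseteq>" 50)
  assumes total: "A \<in> Ev \<Longrightarrow> B \<in> Ev \<Longrightarrow> A \<sqsubseteq> B \<or> B \<sqsubseteq> A"
    and trans: "A \<in> Ev \<Longrightarrow> B \<in> Ev \<Longrightarrow> C \<in> Ev \<Longrightarrow> A \<sqsubseteq> B \<Longrightarrow> B \<sqsubseteq> C \<Longrightarrow> A \<sqsubseteq> C"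
    and empty_le: "A \<in> Ev \<Longrightarrow> {} \<sqsubseteq> A"
    and nontrivial: "\<not> UNIV \<sqsubseteq> {}"
    and add_iff: "A \<in> Ev \<Longrightarrow> B \<in> Ev \<Longrightarrow> C \<in> Ev \<Longrightarrow> A \<inter> C = {} \<Longrightarrow> B \<inter> C = {} \<Longrightarrow>
      A \<union> C \<sqsubseteq> B \<union> C \<longleftrightarrow> A \<sqsubseteq> B"
    and fine: "A \<in> Ev \<Longrightarrow> B \<in> Ev \<Longrightarrow> \<not> B \<sqsubseteq> A \<Longrightarrow>
      \<exists>\<P>. finite \<P> \<and> \<P> \<subseteq> Ev \<and> \<Union>\<P> = UNIV \<and> (\<forall>C\<in>\<P>. \<not> B \<sqsubseteq> A \<union> C)"
begin

abbreviation lt (infix "\<sqsubset>" 50) where "A \<sqsubset> B \<equiv> \<not> B \<sqsubseteq> A"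

lemma refl: "A \<in> Ev \<Longrightarrow> A \<sqsubseteq> A"
  using total by blast

lemma lt_le: "A \<in> Ev \<Longrightarrow> B \<in> Ev \<Longrightarrow> A \<sqsubset> B \<Longrightarrow> A \<sqsubseteq> B"
  using total by blast

lemma mono:
  assumes "A \<in> Ev" "B \<in> Ev" "A \<subseteq> B"
  shows "A \<sqsubseteq> B"
proof -
  have "{} \<union> A \<sqsubseteq> (B - A) \<union> A"
    using assms empty_le[of "B - A"] by (subst add_iff) auto
  moreover have "(B - A) \<union> A = B"
    using assms by blast
  ultimately show ?thesis
    by simp
qed

lemma mono_trans:
  assumes "A \<in> Ev" "B \<in> Ev" "B' \<in> Ev" "A' \<in> Ev" "A \<sqsubseteq> B" "A' \<subseteq> A" "B \<subseteq> B'"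
  shows "A' \<sqsubseteq> B'"
  using assms trans[of A' A B] trans[of A' B B'] mono[of A' A] mono[of B B'] by blast

text \<open>
  With \<open>A\<close> and \<open>C\<close> disjoint, the comparison goes through \<open>B \<union> C\<close>: first \<open>A\<close> is exchanged for \<open>B\<close>
  next to \<open>C - B\<close>, then \<open>C\<close> for \<open>D\<close> next to \<open>B - C\<close>, and finally the common part \<open>B \<inter> C\<close>, which is
  disjoint from both sides, is restored.
\<close>

lemma disjoint_sum:
  assumes ev: "A \<in> Ev" "B \<in> Ev" "C \<in> Ev" "D \<in> Ev"
    and disj: "A \<inter> C = {}" "B \<inter> D = {}" and le: "C \<sqsubseteq> D"
  shows "A \<sqsubseteq> B \<Longrightarrow> A \<union> C \<sqsubseteq> B \<union> D" and "B \<union> D \<sqsubseteq> A \<union> C \<Longrightarrow> B \<sqsubseteq> A"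
proof -
  have ev': "C - B \<in> Ev" "B - C \<in> Ev" "B \<inter> C \<in> Ev"
    using ev by (auto intro: Int Diff)
  have eqs: "B \<union> (C - B) = C \<union> (B - C)" "A \<union> C = (A \<union> (C - B)) \<union> (B \<inter> C)"
      "B \<union> D = (D \<union> (B - C)) \<union> (B \<inter> C)"
    by auto
  have 1: "C \<union> (B - C) \<sqsubseteq> D \<union> (B - C)"
    using le disj by (subst add_iff) (use ev ev' in auto)
  have 2: "A \<union> C \<sqsubseteq> B \<union> D \<longleftrightarrow> A \<union> (C - B) \<sqsubseteq> D \<union> (B - C)"
    unfolding eqs(2,3) using disj by (subst add_iff) (use ev ev' in auto)
  have 3: "B \<union> D \<sqsubseteq> A \<union> C \<longleftrightarrow> D \<union> (B - C) \<sqsubseteq> A \<union> (C - B)"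
    unfolding eqs(2,3) using disj by (subst add_iff) (use ev ev' in auto)
  have 4: "A \<union> (C - B) \<sqsubseteq> B \<union> (C - B) \<longleftrightarrow> A \<sqsubseteq> B"
    using disj by (subst add_iff) (use ev ev' in auto)
  have 5: "B \<union> (C - B) \<sqsubseteq> A \<union> (C - B) \<longleftrightarrow> B \<sqsubseteq> A"
    using disj by (subst add_iff) (use ev ev' in auto)
  have ev'': "A \<union> (C - B) \<in> Ev" "D \<union> (B - C) \<in> Ev" "C \<union> (B - C) \<in> Ev"
    using ev ev' by auto
  show "A \<union> C \<sqsubseteq> B \<union> D" if "A \<sqsubseteq> B"
    using that 1 2 4 eqs(1) trans ev'' by metis
  show "B \<sqsubseteq> A" if "B \<union> D \<sqsubseteq> A \<union> C"
    using that 1 3 5 eqs(1) trans ev'' by metis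
qed

lemma sum_le:
  assumes ev: "A \<in> Ev" "B \<in> Ev" "C \<in> Ev" "D \<in> Ev"
    and "A \<sqsubseteq> B" "C \<sqsubseteq> D" "B \<inter> D = {}"
  shows "A \<union> C \<sqsubseteq> B \<union> D"
proof -
  have "C - A \<sqsubseteq> D"
    using mono_trans[of C D D "C - A"] assms by (auto simp: Diff)
  then show ?thesis
    using disjoint_sum(1)[of A B "C - A" D] assms by (simp add: Diff Int_Diff)
qed

lemma sum_less:
  assumes ev: "A \<in> Ev" "B \<in> Ev" "C \<in> Ev" "D \<in> Ev"
    and "A \<sqsubset> B" "C \<sqsubseteq> D" "B \<inter> D = {}"
  shows "A \<union> C \<sqsubset> B \<union> D"
proof -
  have "C - A \<sqsubseteq> D"
    using mono_trans[of C D D "C - A"] assms by (auto simp: Diff)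
  then show ?thesis
    using disjoint_sum(2)[of A B "C - A" D] assms by (auto simp: Diff)
qed

lemma null_Union:
  assumes "finite \<P>" "\<P> \<subseteq> Ev" "\<And>C. C \<in> \<P> \<Longrightarrow> C \<sqsubseteq> {}"
  shows "\<Union>\<P> \<sqsubseteq> {}"
  using assms
proof (induction \<P>)
  case empty
  then show ?case using refl[of "{}"] by simp
next
  case (insert C \<P>)
  then show ?case
    using sum_le[of C "{}" "\<Union>\<P>" "{}"] finite_Union[of \<P>] by auto
qed

lemma diff_null:
  assumes "A \<in> Ev" "B \<in> Ev" "A - B \<sqsubseteq> {}"
  shows "A \<sqsubseteq> B"
proof -
  have "B \<union> (A - B) \<sqsubseteq> B \<union> {}"
    using assms by (intro sum_le) (auto intro: refl Diff)
  then show ?thesis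
    using mono_trans[of "B \<union> (A - B)" B B A] assms by (auto simp: Diff)
qed

text \<open>
  A cell \<open>C\<close> of a fine cover may lie inside \<open>A\<close>, but not every \<open>C - A\<close> can be null, since
  otherwise \<open>A\<close> would be as likely as the whole space.
\<close>

lemma gap:
  assumes "A \<in> Ev" "B \<in> Ev" "A \<sqsubset> B"
  obtains D where "D \<in> Ev" "A \<inter> D = {}" "{} \<sqsubset> D" "A \<union> D \<sqsubset> B"
proof -
  obtain \<P> where P: "finite \<P>" "\<P> \<subseteq> Ev" "\<Union>\<P> = UNIV" "\<And>C. C \<in> \<P> \<Longrightarrow> A \<union> C \<sqsubset> B"
    using fine[OF assms] by blast
  have "\<exists>C\<in>\<P>. {} \<sqsubset> C - A"
  proof (rule ccontr)
    assume "\<not> ?thesis"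
    then have "\<Union>((\<lambda>C. C - A) ` \<P>) \<sqsubseteq> {}"
      using P assms by (intro null_Union) (auto intro: Diff)
    moreover have "\<Union>((\<lambda>C. C - A) ` \<P>) = UNIV - A"
      using P by auto
    ultimately have "UNIV \<sqsubseteq> A"
      using diff_null[of UNIV A] assms by simp
    then show False
      using mono_trans[of UNIV A A B] assms by auto
  qed
  then obtain C where "C \<in> \<P>" "{} \<sqsubset> C - A"
    by blast
  moreover have "A \<union> (C - A) = A \<union> C"
    by auto
  ultimately show ?thesis
    using that[of "C - A"] P assms by (auto intro: Diff)
qed

lemma small_cover:
  assumes "X \<in> Ev" "{} \<sqsubset> X"
  shows "\<exists>\<P>. finite \<P> \<and> \<P> \<subseteq> Ev \<and> \<Union>\<P> = UNIV \<and> (\<forall>C\<in>\<P>. C \<sqsubset> X)"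
  using fine[of "{}" X] assms by simp

text \<open>
  A cell that is less likely than \<open>X\<close> and meets \<open>X\<close> in a non-null event leaves a non-null rest;
  \<open>Y\<close> is the less likely of the two parts. Hence there are no atoms.
\<close>

lemma split:
  assumes "X \<in> Ev" "{} \<sqsubset> X"
  obtains Y where "Y \<in> Ev" "Y \<subseteq> X" "{} \<sqsubset> Y" "Y \<sqsubseteq> X - Y"
proof -
  obtain \<P> where P: "finite \<P>" "\<P> \<subseteq> Ev" "\<Union>\<P> = UNIV" "\<And>C. C \<in> \<P> \<Longrightarrow> C \<sqsubset> X"
    using small_cover[OF assms] by blast
  have "\<exists>C\<in>\<P>. {} \<sqsubset> X \<inter> C"
  proof (rule ccontr)
    assume "\<not> ?thesis"
    then have "\<Union>((\<lambda>C. X \<inter> C) ` \<P>) \<sqsubseteq> {}"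
      using P assms by (intro null_Union) (auto intro: Int)
    moreover have "\<Union>((\<lambda>C. X \<inter> C) ` \<P>) = X"
      using P by auto
    ultimately show False
      using assms by simp
  qed
  then obtain C where C: "C \<in> \<P>" "{} \<sqsubset> X \<inter> C"
    by blast
  have "{} \<sqsubset> X - C"
    using diff_null[of X C] P(2,4) C(1) assms by auto
  define Y where "Y = (if X \<inter> C \<sqsubseteq> X - C then X \<inter> C else X - C)"
  have XY: "X - Y = (if X \<inter> C \<sqsubseteq> X - C then X - C else X \<inter> C)"
    unfolding Y_def by auto
  have ev: "X \<inter> C \<in> Ev" "X - C \<in> Ev"
    using P C assms by (auto intro: Int Diff)
  show ?thesis
  proof (rule that[of Y])
    show "Y \<sqsubseteq> X - Y"
      unfolding XY using Y_def total[OF ev] by auto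
  qed (use Y_def ev C \<open>{} \<sqsubset> X - C\<close> in auto)
qed

text \<open>
  Sequences that become negligible. The next member is at most as likely as what is removed, so
  the removed parts are infinitely many disjoint events of at least the size of any later member.
\<close>

definition halving :: "(nat \<Rightarrow> 's set) \<Rightarrow> bool" where
  "halving X \<longleftrightarrow> (\<forall>n. X n \<in> Ev \<and> {} \<sqsubset> X n \<and> X (Suc n) \<subseteq> X n \<and> X (Suc n) \<sqsubseteq> X n - X (Suc n))"

lemma halving_exists: "\<exists>X. halving X"
proof -
  have "\<exists>X. \<forall>n. (X n \<in> Ev \<and> {} \<sqsubset> X n) \<and> (X (Suc n) \<subseteq> X n \<and> X (Suc n) \<sqsubseteq> X n - X (Suc n))"
  proof (rule dependent_nat_choice)
    show "\<exists>X. X \<in> Ev \<and> {} \<sqsubset> X"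
      using nontrivial by blast
    show "\<exists>Y. (Y \<in> Ev \<and> {} \<sqsubset> Y) \<and> (Y \<subseteq> X \<and> Y \<sqsubseteq> X - Y)" if "X \<in> Ev \<and> {} \<sqsubset> X" for X and n :: nat
      using that split[of X] by blast
  qed
  then show ?thesis
    unfolding halving_def by blast
qed

lemma halving_antimono: "halving X \<Longrightarrow> m \<le> n \<Longrightarrow> X n \<subseteq> X m"
  unfolding halving_def by (metis lift_Suc_antimono_le)

text \<open>
  If all members were at least as likely as \<open>Y\<close>, the disjoint differences \<open>X j - X (Suc j)\<close> would be
  so too. A finite cover by events less likely than \<open>Y\<close> would then be outweighed by equally many
  of these differences, which still miss the non-null event \<open>X (card \<P>)\<close>.
\<close>

lemma halving_small:
  assumes X: "halving X" and "Y \<in> Ev" "{} \<sqsubset> Y"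
  obtains n where "\<And>m. m \<ge> n \<Longrightarrow> X m \<sqsubset> Y"
proof -
  have ev: "X n \<in> Ev" for n
    using X by (auto simp: halving_def)
  have "\<exists>n. X n \<sqsubset> Y"
  proof (rule ccontr)
    assume "\<not> ?thesis"
    then have Y_le: "Y \<sqsubseteq> X n" for n
      by blast
    obtain \<P> where P: "finite \<P>" "\<P> \<subseteq> Ev" "\<Union>\<P> = UNIV" "\<And>C. C \<in> \<P> \<Longrightarrow> C \<sqsubset> Y"
      using small_cover[of Y] assms by blast
    have "\<Union>\<P> \<sqsubseteq> X 0 - X (card \<P>)"
      using P(1,2,4)
    proof (induction \<P>)
      case empty
      then show ?case using refl[of "{}"] by simp
    next
      case (insert C \<P>)
      let ?n = "card \<P>"
      have "Y \<sqsubseteq> X ?n - X (Suc ?n)"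
        using Y_le[of "Suc ?n"] X trans[OF \<open>Y \<in> Ev\<close> ev[of "Suc ?n"] Diff[OF ev ev]]
        by (auto simp: halving_def)
      then have "C \<sqsubseteq> X ?n - X (Suc ?n)"
        using insert.prems \<open>Y \<in> Ev\<close> trans[of C Y "X ?n - X (Suc ?n)"] lt_le[of C Y] ev
        by (auto simp: Diff)
      then have "\<Union>\<P> \<union> C \<sqsubseteq> (X 0 - X ?n) \<union> (X ?n - X (Suc ?n))"
        using insert ev by (intro sum_le) (auto intro: Diff finite_Union)
      moreover have "(X 0 - X ?n) \<union> (X ?n - X (Suc ?n)) = X 0 - X (card (insert C \<P>))"
        using insert.hyps halving_antimono[OF X, of 0 ?n] halving_antimono[OF X, of ?n "Suc ?n"]
        by auto
      ultimately show ?case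
        by (simp add: Un_commute)
    qed
    then have "UNIV \<sqsubseteq> UNIV - X (card \<P>)"
      using P(3) mono_trans[of UNIV "X 0 - X (card \<P>)" "UNIV - X (card \<P>)" UNIV] ev
      by (auto simp: Diff)
    then have "X (card \<P>) \<sqsubseteq> {}"
      using add_iff[of "X (card \<P>)" "{}" "UNIV - X (card \<P>)"] ev[of "card \<P>"] by (simp add: Diff)
    then show False
      using X by (auto simp: halving_def)
  qed
  then obtain n where "X n \<sqsubset> Y"
    by blast
  then have "X m \<sqsubset> Y" if "m \<ge> n" for m
    using mono_trans[of Y "X m" "X n" Y] halving_antimono[OF X that] ev \<open>Y \<in> Ev\<close> by auto
  then show ?thesis
    using that by blast
qed

text \<open>
  Adding the cells of a fine cover to \<open>L\<close> one after the other leads from \<open>L\<close> to \<open>H\<close>, so \<open>\<Phi>\<close>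
  switches from true to false at some cell.
\<close>

lemma refine_switch:
  assumes ev: "L \<in> Ev" "H \<in> Ev" "Y \<in> Ev" and "L \<subseteq> H" "\<Phi> L" "\<not> \<Phi> H" "{} \<sqsubset> Y"
  obtains L' H' where "L' \<in> Ev" "H' \<in> Ev" "L \<subseteq> L'" "L' \<subseteq> H'" "H' \<subseteq> H" "\<Phi> L'" "\<not> \<Phi> H'"
    "H' - L' \<sqsubseteq> Y"
proof -
  obtain \<P> where P: "finite \<P>" "\<P> \<subseteq> Ev" "\<Union>\<P> = UNIV" "\<And>C. C \<in> \<P> \<Longrightarrow> C \<sqsubset> Y"
    using small_cover[of Y] assms by blast
  have "\<exists>L' H'. L' \<in> Ev \<and> H' \<in> Ev \<and> L \<subseteq> L' \<and> L' \<subseteq> H' \<and> H' \<subseteq> H \<and> \<Phi> L' \<and> \<not> \<Phi> H' \<and> H' - L' \<sqsubseteq> Y"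
    if "H - L \<subseteq> \<Union>\<P>"
    using P(1,2,4) that ev(2) \<open>L \<subseteq> H\<close> \<open>\<not> \<Phi> H\<close>
  proof (induction \<P> arbitrary: H)
    case empty
    then have "H = L"
      by auto
    then show ?case
      using empty \<open>\<Phi> L\<close> by simp
  next
    case (insert C \<P>)
    let ?H = "L \<union> (H - C)"
    have C: "C \<in> Ev" "C \<sqsubseteq> Y"
      using insert.prems ev lt_le by auto
    have H: "?H \<in> Ev" "L \<subseteq> ?H" "?H \<subseteq> H" "?H - L \<subseteq> \<Union>\<P>"
      using insert.prems ev C by auto
    show ?case
    proof (cases "\<Phi> ?H")
      case True
      moreover have "H - ?H \<sqsubseteq> Y"
        using mono_trans[of C Y Y "H - ?H"] C ev H insert.prems by (auto intro: Diff)
      ultimately show ?thesis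
        using H insert.prems by blast
    next
      case False
      then have "\<exists>L' H'. L' \<in> Ev \<and> H' \<in> Ev \<and> L \<subseteq> L' \<and> L' \<subseteq> H' \<and> H' \<subseteq> ?H \<and> \<Phi> L' \<and> \<not> \<Phi> H' \<and> H' - L' \<sqsubseteq> Y"
        using insert.prems H by (intro insert.IH) auto
      then show ?thesis
        using H(3) by (meson subset_trans)
    qed
  qed
  then show ?thesis
    using that P(3) by auto
qed

text \<open>
  An intermediate value theorem without countable additivity. The union \<open>A\<close> of the lower events
  need not inherit any property from them by continuity; all that is known is that \<open>A\<close> lies between
  an event with \<open>\<Phi>\<close> and one without, up to an arbitrarily small difference.
\<close>

lemma squeeze:
  assumes X: "halving X" and "B \<in> Ev" "\<Phi> {}" "\<not> \<Phi> B"
  obtains A L H where "A \<in> Ev" "A \<subseteq> B"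
    "\<And>n. L n \<in> Ev" "\<And>n. H n \<in> Ev" "\<And>n. L n \<subseteq> A" "\<And>n. A \<subseteq> H n" "\<And>n. H n \<subseteq> B"
    "\<And>n. \<Phi> (L n)" "\<And>n. \<not> \<Phi> (H n)" "\<And>n. H n - L n \<sqsubseteq> X n"
proof -
  define good where "good n p \<longleftrightarrow> fst p \<in> Ev \<and> snd p \<in> Ev \<and> fst p \<subseteq> snd p \<and> snd p \<subseteq> B \<and>
    \<Phi> (fst p) \<and> \<not> \<Phi> (snd p) \<and> snd p - fst p \<sqsubseteq> X n" for n and p :: "'s set \<times> 's set"
  have evX: "X n \<in> Ev" "{} \<sqsubset> X n" for n
    using X by (auto simp: halving_def)
  have "\<exists>p. \<forall>n. good n (p n) \<and> (fst (p n) \<subseteq> fst (p (Suc n)) \<and> snd (p (Suc n)) \<subseteq> snd (p n))"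
  proof (rule dependent_nat_choice)
    obtain L H where "L \<in> Ev" "H \<in> Ev" "{} \<subseteq> L" "L \<subseteq> H" "H \<subseteq> B" "\<Phi> L" "\<not> \<Phi> H" "H - L \<sqsubseteq> X 0"
      using refine_switch[of "{}" B "X 0" \<Phi>] assms evX by auto
    then have "good 0 (L, H)"
      by (simp add: good_def)
    then show "\<exists>p. good 0 p" ..
    show "\<exists>q. good (Suc n) q \<and> (fst p \<subseteq> fst q \<and> snd q \<subseteq> snd p)" if p: "good n p" for p n
    proof -
      obtain L H where "L \<in> Ev" "H \<in> Ev" "fst p \<subseteq> L" "L \<subseteq> H" "H \<subseteq> snd p" "\<Phi> L" "\<not> \<Phi> H"
          "H - L \<sqsubseteq> X (Suc n)"
        using refine_switch[of "fst p" "snd p" "X (Suc n)" \<Phi>] p evX unfolding good_def by metis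
      then have "good (Suc n) (L, H) \<and> (fst p \<subseteq> fst (L, H) \<and> snd (L, H) \<subseteq> snd p)"
        using p by (auto simp: good_def)
      then show ?thesis ..
    qed
  qed
  then obtain p where good: "\<And>n. good n (p n)"
    and step: "\<And>n. fst (p n) \<subseteq> fst (p (Suc n))" "\<And>n. snd (p (Suc n)) \<subseteq> snd (p n)"
    by blast
  define A where "A = (\<Union>n. fst (p n))"
  have ev: "A \<in> Ev"
    unfolding A_def using good by (intro countable_UN) (auto simp: good_def)
  have "fst (p m) \<subseteq> snd (p n)" for m n
  proof -
    have "fst (p m) \<subseteq> fst (p (max m n))"
      using step(1) by (rule lift_Suc_mono_le) simp
    also have "\<dots> \<subseteq> snd (p (max m n))"
      using good by (simp add: good_def)
    also have "\<dots> \<subseteq> snd (p n)"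
      using step(2) by (rule lift_Suc_antimono_le) simp
    finally show ?thesis .
  qed
  then have bounds: "fst (p n) \<subseteq> A" "A \<subseteq> snd (p n)" for n
    unfolding A_def by auto
  then have "A \<subseteq> B"
    using bounds(2)[of 0] good[of 0] unfolding good_def by blast
  then show ?thesis
    using good[unfolded good_def] bounds ev
    by (intro that[of A "\<lambda>n. fst (p n)" "\<lambda>n. snd (p n)"]) auto
qed

text \<open>
  The slack consists of two events because a gap between \<open>L n\<close> and \<open>H n\<close> enters the bisection
  argument twice, once on each side of the comparison.
\<close>

lemma le_if_almost:
  assumes ev: "A \<in> Ev" "B \<in> Ev"
    and almost: "\<And>C D. C \<in> Ev \<Longrightarrow> D \<in> Ev \<Longrightarrow> {} \<sqsubset> C \<Longrightarrow> {} \<sqsubset> D \<Longrightarrow>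
      C \<inter> D = {} \<Longrightarrow> B \<inter> (C \<union> D) = {} \<Longrightarrow> A \<sqsubseteq> B \<union> C \<union> D"
  shows "A \<sqsubseteq> B"
proof (rule ccontr)
  assume "\<not> A \<sqsubseteq> B"
  then obtain D where D: "D \<in> Ev" "B \<inter> D = {}" "{} \<sqsubset> D" "B \<union> D \<sqsubset> A"
    using gap[of B A] ev by metis
  obtain C where C: "C \<in> Ev" "C \<subseteq> D" "{} \<sqsubset> C" "C \<sqsubseteq> D - C"
    using split[OF D(1,3)] by metis
  have "{} \<sqsubset> D - C"
    using C D trans[of C "D - C" "{}"] by (auto simp: Diff)
  moreover have "B \<union> C \<union> (D - C) = B \<union> D"
    using C by auto
  ultimately show False
    using almost[of C "D - C"] C D by (auto simp: Diff)
qed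

text \<open>
  The squeeze is applied to the property of being at most as likely as the remainder of \<open>B\<close>.
\<close>

lemma bisect:
  assumes B: "B \<in> Ev" "{} \<sqsubset> B"
  obtains A where "A \<in> Ev" "A \<subseteq> B" "A \<sqsubseteq> B - A" "B - A \<sqsubseteq> A"
proof -
  obtain X where X: "halving X"
    using halving_exists by blast
  have "{} \<sqsubseteq> B - {}" "\<not> B \<sqsubseteq> B - B"
    using B empty_le by auto
  then obtain A L H where A: "A \<in> Ev" "A \<subseteq> B"
    and ev: "\<And>n. L n \<in> Ev" "\<And>n. H n \<in> Ev" and sub: "\<And>n. L n \<subseteq> A" "\<And>n. A \<subseteq> H n" "\<And>n. H n \<subseteq> B"
    and low: "\<And>n. L n \<sqsubseteq> B - L n" and high: "\<And>n. \<not> H n \<sqsubseteq> B - H n"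
    and gap: "\<And>n. H n - L n \<sqsubseteq> X n"
    using squeeze[OF X, of B "\<lambda>L. L \<sqsubseteq> B - L"] B by metis
  have evX: "X n \<in> Ev" for n
    using X by (auto simp: halving_def)
  have small: "\<exists>n. \<forall>G\<in>Ev. G \<subseteq> H n - L n \<longrightarrow> G \<sqsubseteq> C \<and> G \<sqsubseteq> D"
    if CD: "C \<in> Ev" "D \<in> Ev" "{} \<sqsubset> C" "{} \<sqsubset> D" for C D
  proof -
    obtain n m where "\<And>i. i \<ge> n \<Longrightarrow> X i \<sqsubset> C" "\<And>i. i \<ge> m \<Longrightarrow> X i \<sqsubset> D"
      using halving_small[OF X CD(1,3)] halving_small[OF X CD(2,4)] by metis
    then have "X (max n m) \<sqsubseteq> C" "X (max n m) \<sqsubseteq> D"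
      using lt_le evX that by simp_all
    then have "H (max n m) - L (max n m) \<sqsubseteq> C" "H (max n m) - L (max n m) \<sqsubseteq> D"
      using trans[OF _ evX _ gap] that ev by (auto simp: Diff)
    then have "G \<sqsubseteq> C \<and> G \<sqsubseteq> D" if "G \<in> Ev" "G \<subseteq> H (max n m) - L (max n m)" for G
      using mono_trans[OF _ CD(1,1) that(1) _ that(2)] mono_trans[OF _ CD(2,2) that(1) _ that(2)] ev
      by (auto simp: Diff)
    then show ?thesis
      by blast
  qed
  show ?thesis
  proof (rule that[of A])
    show "A \<sqsubseteq> B - A"
    proof (rule le_if_almost)
      fix C D
      assume CD: "C \<in> Ev" "D \<in> Ev" "{} \<sqsubset> C" "{} \<sqsubset> D" "C \<inter> D = {}" "(B - A) \<inter> (C \<union> D) = {}"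
      obtain n where n: "\<And>G. G \<in> Ev \<Longrightarrow> G \<subseteq> H n - L n \<Longrightarrow> G \<sqsubseteq> C \<and> G \<sqsubseteq> D"
        using small CD by metis
      have "A - L n \<in> Ev" "A - L n \<subseteq> H n - L n"
        using A ev sub(1)[of n] sub(2)[of n] by auto
      note G = this n[OF this]
      have eq: "B - L n = (B - A) \<union> (A - L n)" "A = L n \<union> (A - L n)"
        using A sub(1)[of n] sub(2)[of n] sub(3)[of n] by blast+
      have "(B - A) \<union> (A - L n) \<sqsubseteq> (B - A) \<union> C"
        using A B G CD by (intro sum_le) (auto intro: refl)
      then have "L n \<sqsubseteq> (B - A) \<union> C"
        using trans[OF ev(1) _ _ low[of n]] eq(1) A B ev CD by (metis Diff Un)
      then have "L n \<union> (A - L n) \<sqsubseteq> ((B - A) \<union> C) \<union> D"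
        using A B G CD ev by (intro sum_le) auto
      then show "A \<sqsubseteq> (B - A) \<union> C \<union> D"
        using eq(2) by simp
    qed (use A B in auto)
    show "B - A \<sqsubseteq> A"
    proof (rule le_if_almost)
      fix C D
      assume CD: "C \<in> Ev" "D \<in> Ev" "{} \<sqsubset> C" "{} \<sqsubset> D" "C \<inter> D = {}" "A \<inter> (C \<union> D) = {}"
      obtain n where n: "\<And>G. G \<in> Ev \<Longrightarrow> G \<subseteq> H n - L n \<Longrightarrow> G \<sqsubseteq> C \<and> G \<sqsubseteq> D"
        using small CD by metis
      have "H n - A \<in> Ev" "H n - A \<subseteq> H n - L n"
        using A ev sub(1)[of n] sub(2)[of n] by auto
      note G = this n[OF this]
      have eq: "H n = A \<union> (H n - A)" "B - A = (B - H n) \<union> (H n - A)"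
        using A sub(1)[of n] sub(2)[of n] sub(3)[of n] by blast+
      have "A \<union> (H n - A) \<sqsubseteq> A \<union> C"
        using A B G CD by (intro sum_le) (auto intro: refl)
      moreover have "B - H n \<sqsubseteq> H n"
        using high[of n] lt_le[of "B - H n" "H n"] B ev by auto
      ultimately have "B - H n \<sqsubseteq> A \<union> C"
        using trans[of "B - H n" "H n" "A \<union> C"] eq(1) A B ev CD by (metis Diff Un)
      then have "(B - H n) \<union> (H n - A) \<sqsubseteq> (A \<union> C) \<union> D"
        using A B G CD ev by (intro sum_le) auto
      then show "B - A \<sqsubseteq> A \<union> C \<union> D"
        using eq(2) by simp
    qed (use A B in auto)
  qed (use A in auto)
qed

end

section \<open>The probability representing a qualitative probability\<close>

context qualitative_probability
begin

text \<open>
  \<open>copies U k A\<close>: the event \<open>A\<close> consists of \<open>k\<close> disjoint events as likely as the unit \<open>U\<close>. Counting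
  copies up to equal likelihood avoids the choice of a fixed tree of nested partitions.
\<close>

inductive copies :: "'s set \<Rightarrow> nat \<Rightarrow> 's set \<Rightarrow> bool" for U where
  none: "copies U 0 {}"
| more: "copies U k A \<Longrightarrow> B \<in> Ev \<Longrightarrow> B \<sqsubseteq> U \<Longrightarrow> U \<sqsubseteq> B \<Longrightarrow> A \<inter> B = {} \<Longrightarrow> copies U (Suc k) (A \<union> B)"

lemma copies_event: "copies U k A \<Longrightarrow> A \<in> Ev"
  by (induction rule: copies.induct) auto

lemma copies_le:
  assumes "copies U k A" "copies U l B" "k \<le> l" "U \<in> Ev"
  shows "A \<sqsubseteq> B"
  using assms(2,1,3)
proof (induction arbitrary: k A rule: copies.induct)
  case none
  then show ?case
    by (auto elim: copies.cases intro: refl)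
next
  case (more l B B' k A)
  note IH = more.IH and hyps = more.hyps and prems = more.prems
  from prems(1) show ?case
  proof cases
    case none
    then show ?thesis
      using empty_le hyps copies_event[OF hyps(1)] by auto
  next
    case (more k' C C')
    have "C \<sqsubseteq> B"
      using more IH prems by auto
    moreover have "C' \<sqsubseteq> B'"
      using more hyps trans[of C' U B'] \<open>U \<in> Ev\<close> by auto
    ultimately show ?thesis
      using more hyps copies_event by (auto intro: sum_le)
  qed
qed

lemma copies_split:
  assumes "copies U (k + l) C"
  obtains A B where "copies U k A" "copies U l B" "A \<inter> B = {}" "A \<union> B = C"
proof -
  have "\<exists>A B. copies U k A \<and> copies U l B \<and> A \<inter> B = {} \<and> A \<union> B = C"
    using assms
  proof (induction l arbitrary: C)
    case 0
    then show ?case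
      by (intro exI[of _ C] exI[of _ "{}"]) (auto intro: copies.none)
  next
    case (Suc l)
    from Suc.prems obtain C' B' where C': "C = C' \<union> B'" "copies U (k + l) C'" "B' \<in> Ev" "B' \<sqsubseteq> U" "U \<sqsubseteq> B'"
        "C' \<inter> B' = {}"
      by (auto elim: copies.cases)
    obtain A B where AB: "copies U k A" "copies U l B" "A \<inter> B = {}" "A \<union> B = C'"
      using Suc.IH[OF C'(2)] by blast
    then have "copies U (Suc l) (B \<union> B')"
      using C' by (intro copies.more) auto
    then show ?case
      using AB C' by (intro exI[of _ A] exI[of _ "B \<union> B'"]) auto
  qed
  then show ?thesis
    using that by blast
qed

text \<open>
  Halving sequences that start from the whole space and split into equally likely parts, so that
  \<open>X n\<close> has the probability \<open>1 / 2\<^sup>n\<close>.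
\<close>

definition bisecting :: "(nat \<Rightarrow> 's set) \<Rightarrow> bool" where
  "bisecting X \<longleftrightarrow> halving X \<and> X 0 = UNIV \<and> (\<forall>n. X n - X (Suc n) \<sqsubseteq> X (Suc n))"

lemma half_null:
  assumes "B \<in> Ev" "A \<in> Ev" "A \<subseteq> B" "B - A \<sqsubseteq> A" "A \<sqsubseteq> {}"
  shows "B \<sqsubseteq> {}"
proof -
  have "B - A \<sqsubseteq> {}"
    using assms trans[of "B - A" A "{}"] by auto
  then have "A \<union> (B - A) \<sqsubseteq> {} \<union> {}"
    using assms by (intro sum_le) auto
  then show ?thesis
    using assms by (simp add: Un_absorb1)
qed

lemma bisecting_exists: "\<exists>X. bisecting X"
proof -
  have "\<exists>X. \<forall>n. (X n \<in> Ev \<and> {} \<sqsubset> X n \<and> (n = 0 \<longrightarrow> X n = UNIV)) \<and>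
    (X (Suc n) \<subseteq> X n \<and> X (Suc n) \<sqsubseteq> X n - X (Suc n) \<and> X n - X (Suc n) \<sqsubseteq> X (Suc n))"
  proof (rule dependent_nat_choice)
    show "\<exists>X. X \<in> Ev \<and> {} \<sqsubset> X \<and> ((0::nat) = 0 \<longrightarrow> X = UNIV)"
      using nontrivial by auto
    show "\<exists>Y. (Y \<in> Ev \<and> {} \<sqsubset> Y \<and> (Suc n = 0 \<longrightarrow> Y = UNIV)) \<and> (Y \<subseteq> X \<and> Y \<sqsubseteq> X - Y \<and> X - Y \<sqsubseteq> Y)"
      if X: "X \<in> Ev \<and> {} \<sqsubset> X \<and> (n = 0 \<longrightarrow> X = UNIV)" for X n
    proof -
      obtain Y where "Y \<in> Ev" "Y \<subseteq> X" "Y \<sqsubseteq> X - Y" "X - Y \<sqsubseteq> Y"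
        using bisect[of X] X by blast
      then show ?thesis
        using half_null[of X Y] X by blast
    qed
  qed
  then show ?thesis
    unfolding bisecting_def halving_def by blast
qed

lemma halves_le:
  assumes ev: "A \<in> Ev" "A' \<in> Ev" "B \<in> Ev" "B' \<in> Ev"
    and disj: "A \<inter> A' = {}" "B \<inter> B' = {}"
    and "A \<sqsubseteq> A'" "B' \<sqsubseteq> B" "A \<union> A' \<sqsubseteq> B \<union> B'"
  shows "A \<sqsubseteq> B"
proof (rule ccontr)
  assume "\<not> A \<sqsubseteq> B"
  moreover have "B' \<sqsubseteq> A'"
    using calculation assms trans[of B' B A] trans[of B' A A'] lt_le[of B A] by blast
  ultimately have "B \<union> B' \<sqsubset> A \<union> A'"
    using assms by (intro sum_less) auto
  then show False
    using assms by blast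
qed

text \<open>
  Every event as likely as \<open>X n\<close> splits into two events as likely as \<open>X (Suc n)\<close>, because halves
  of equally likely events are equally likely.
\<close>

lemma copies_bisect:
  assumes X: "bisecting X" and "copies (X n) k A"
  shows "copies (X (Suc n)) (2 * k) A"
  using assms(2)
proof (induction rule: copies.induct)
  case none
  show ?case
    using copies.none by simp
next
  case (more k A B)
  let ?Y = "X (Suc n)" and ?Z = "X n - X (Suc n)"
  have ev: "X n \<in> Ev" "?Y \<in> Ev" "?Z \<in> Ev" and pos: "{} \<sqsubset> X n"
    and un: "?Y \<union> ?Z = X n" "?Y \<inter> ?Z = {}" and YZ: "?Y \<sqsubseteq> ?Z" "?Z \<sqsubseteq> ?Y"
    using X unfolding bisecting_def halving_def by auto
  have "{} \<sqsubset> B"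
    using pos trans[of "X n" B "{}"] more.hyps ev by auto
  then obtain C where C: "C \<in> Ev" "C \<subseteq> B" "C \<sqsubseteq> B - C" "B - C \<sqsubseteq> C"
    using bisect[of B] more.hyps by blast
  have CB: "C \<union> (B - C) = B" "B - C \<in> Ev" "(B - C) \<union> C = B"
    using C more.hyps by auto
  have "C \<sqsubseteq> ?Y" "B - C \<sqsubseteq> ?Y" "?Y \<sqsubseteq> C" "?Y \<sqsubseteq> B - C"
    using halves_le[of C "B - C" ?Y ?Z] halves_le[of "B - C" C ?Y ?Z]
      halves_le[of ?Y ?Z C "B - C"] halves_le[of ?Y ?Z "B - C" C] ev un YZ C CB more.hyps
    by auto
  then have "copies ?Y (Suc (Suc (2 * k))) ((A \<union> C) \<union> (B - C))"
    using more C CB by (intro copies.more) auto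
  moreover have "(A \<union> C) \<union> (B - C) = A \<union> B"
    using C by auto
  ultimately show ?case
    by simp
qed

lemma copies_refine:
  assumes X: "bisecting X" and "copies (X n) k A"
  shows "copies (X (n + m)) (2 ^ m * k) A"
proof (induction m)
  case 0
  then show ?case using assms by simp
next
  case (Suc m)
  then show ?case
    using copies_bisect[OF X Suc] by (simp add: mult.assoc)
qed

lemma copies_UNIV:
  assumes "bisecting X"
  shows "copies (X n) (2 ^ n) UNIV"
proof -
  have "copies (X 0) (Suc 0) ({} \<union> UNIV)"
    using assms by (intro copies.intros) (auto simp: bisecting_def intro: refl)
  then show ?thesis
    using copies_refine[OF assms, of 0 "Suc 0" UNIV n] by simp
qed

definition grid :: "(nat \<Rightarrow> 's set) \<Rightarrow> 's set \<Rightarrow> real set" where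
  "grid X A = {real k / 2 ^ n | k n. \<exists>C. copies (X n) k C \<and> C \<sqsubseteq> A}"

definition prob_of :: "(nat \<Rightarrow> 's set) \<Rightarrow> 's set \<Rightarrow> real" where
  "prob_of X A = Sup (grid X A)"

context
  fixes X
  assumes X: "bisecting X"
begin

lemma unit: "X n \<in> Ev" "{} \<sqsubset> X n" and X_halving: "halving X"
  using X by (auto simp: bisecting_def halving_def)

lemma copies_less:
  assumes "copies (X n) k A" "copies (X n) l B" "k < l"
  shows "A \<sqsubset> B"
proof
  assume "B \<sqsubseteq> A"
  have "copies (X n) (Suc k + (l - Suc k)) B"
    using assms by simp
  then obtain C D where CD: "copies (X n) (Suc k) C" "copies (X n) (l - Suc k) D" "C \<union> D = B"
    by (metis copies_split)
  obtain A' E where "C = A' \<union> E" "copies (X n) k A'" "E \<in> Ev" "X n \<sqsubseteq> E" "A' \<inter> E = {}"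
    using CD(1) by (auto elim: copies.cases)
  moreover have "{} \<sqsubset> E"
    using calculation unit[of n] trans[of "X n" E "{}"] by auto
  moreover have "A \<sqsubseteq> A'"
    using calculation assms copies_le unit by blast
  ultimately have "{} \<union> A \<sqsubset> E \<union> A'"
    using assms copies_event by (intro sum_less) auto
  moreover have "E \<union> A' \<sqsubseteq> A"
    using \<open>B \<sqsubseteq> A\<close> \<open>C = A' \<union> E\<close> CD mono_trans[of B A A "E \<union> A'"] copies_event[OF assms(1)] copies_event[OF assms(2)]
      copies_event[OF CD(1)] by (auto simp: Un_commute)
  ultimately show False
    by simp
qed

lemma copies_bound:
  assumes "copies (X n) k A"
  shows "k \<le> 2 ^ n"
proof (rule ccontr)
  assume "\<not> k \<le> 2 ^ n"
  then have "UNIV \<sqsubset> A"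
    using copies_less[OF copies_UNIV[OF X] assms] by simp
  then show False
    using mono[of A UNIV] copies_event[OF assms] by auto
qed

lemma copies_exist:
  assumes "k \<le> 2 ^ n"
  obtains C where "copies (X n) k C"
proof -
  have "copies (X n) (k + (2 ^ n - k)) UNIV"
    using copies_UNIV[OF X, of n] assms by simp
  then show ?thesis
    using that by (metis copies_split)
qed

lemma grid_bound: "x \<in> grid X A \<Longrightarrow> x \<le> 1"
proof -
  assume "x \<in> grid X A"
  then obtain k n C where x: "x = real k / 2 ^ n" and "copies (X n) k C"
    unfolding grid_def by blast
  then have "real k \<le> real (2 ^ n)"
    using copies_bound by (metis of_nat_le_iff)
  then show "x \<le> 1"
    unfolding x by simp
qed

lemma zero_in_grid:
  assumes "A \<in> Ev"
  shows "0 \<in> grid X A"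
proof -
  have "real 0 / 2 ^ 0 \<in> grid X A"
    unfolding grid_def using copies.none[of "X 0"] empty_le[OF assms] by blast
  then show ?thesis
    by simp
qed

lemma prob_upper: "x \<in> grid X A \<Longrightarrow> x \<le> prob_of X A"
  unfolding prob_of_def using grid_bound by (intro cSup_upper) (auto simp: bdd_above_def)

text \<open>
  The largest number \<open>k\<close> of copies of \<open>X n\<close> that is at most as likely as \<open>A\<close> determines the
  probability of \<open>A\<close> up to \<open>1 / 2\<^sup>n\<close>: finer copies are compared with coarser ones at the common
  level \<open>n + m\<close>.
\<close>

lemma level:
  assumes A: "A \<in> Ev"
  obtains k C where "copies (X n) k C" "C \<sqsubseteq> A" "\<And>D. copies (X n) (Suc k) D \<Longrightarrow> A \<sqsubset> D"
    "real k / 2 ^ n \<le> prob_of X A" "prob_of X A \<le> real (Suc k) / 2 ^ n"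
proof -
  have "\<exists>k. (\<exists>C. copies (X n) k C \<and> C \<sqsubseteq> A) \<and> \<not> (\<exists>C. copies (X n) (Suc k) C \<and> C \<sqsubseteq> A)"
  proof (rule ccontr)
    assume *: "\<not> ?thesis"
    have "\<exists>C. copies (X n) k C \<and> C \<sqsubseteq> A" for k
    proof (induction k)
      case 0
      then show ?case using copies.none empty_le[OF A] by blast
    qed (use * in blast)
    then have "Suc (2 ^ n) \<le> 2 ^ n"
      using copies_bound by blast
    then show False
      by simp
  qed
  then obtain k C where k: "copies (X n) k C" "C \<sqsubseteq> A" "\<And>D. copies (X n) (Suc k) D \<Longrightarrow> A \<sqsubset> D"
    by blast
  have "prob_of X A \<le> real (Suc k) / 2 ^ n"
    unfolding prob_of_def
  proof (rule cSup_least)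
    show "grid X A \<noteq> {}"
      using zero_in_grid[OF A] by blast
    fix x
    assume "x \<in> grid X A"
    then obtain j m D where x: "x = real j / 2 ^ m" and D: "copies (X m) j D" "D \<sqsubseteq> A"
      unfolding grid_def by blast
    show "x \<le> real (Suc k) / 2 ^ n"
    proof (rule ccontr)
      assume "\<not> ?thesis"
      then have "real (2 ^ m * Suc k) < real (2 ^ n * j)"
        unfolding x by (simp add: field_simps)
      then have less: "2 ^ m * Suc k < 2 ^ n * j"
        by (rule of_nat_less_imp_less)
      also have "\<dots> \<le> 2 ^ n * 2 ^ m"
        using copies_bound[OF D(1)] by simp
      finally have "2 ^ m * Suc k < 2 ^ m * 2 ^ n"
        by (simp only: mult.commute)
      then have "Suc k \<le> 2 ^ n"
        unfolding mult_less_cancel1 by simp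
      then obtain E where E: "copies (X n) (Suc k) E"
        using copies_exist by blast
      have "copies (X (n + m)) (2 ^ m * Suc k) E" "copies (X (n + m)) (2 ^ n * j) D"
        using copies_refine[OF X E, of m] copies_refine[OF X D(1), of n] by (simp_all add: add.commute)
      then have "E \<sqsubseteq> D"
        using less by (intro copies_le[of "X (n + m)"]) (auto intro: unit)
      then show False
        using k(3)[OF E] D E A trans[of E D A] copies_event by blast
    qed
  qed
  moreover have "real k / 2 ^ n \<le> prob_of X A"
    using k by (intro prob_upper) (auto simp: grid_def)
  ultimately show ?thesis
    using that k by blast
qed

lemma prob_mono:
  assumes "A \<in> Ev" "B \<in> Ev" "A \<sqsubseteq> B"
  shows "prob_of X A \<le> prob_of X B"
proof -
  have "grid X A \<subseteq> grid X B"
    unfolding grid_def using trans[OF copies_event assms(1,2) _ assms(3)] by blast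
  then show ?thesis
    unfolding prob_of_def using zero_in_grid[OF assms(1)] grid_bound
    by (intro cSup_subset_mono) (auto simp: bdd_above_def)
qed

lemma dyadic_zero:
  fixes x :: real
  assumes "\<And>n. x \<le> c / 2 ^ n"
  shows "x \<le> 0"
proof (rule LIMSEQ_le_const)
  show "(\<lambda>n. c / 2 ^ n) \<longlonglongrightarrow> 0"
    by (rule LIMSEQ_divide_realpow_zero) simp
qed (use assms in auto)

text \<open>
  If \<open>k\<close> and \<open>l\<close> are the largest numbers of copies below \<open>A\<close> and \<open>B\<close>, the one for \<open>A \<union> B\<close> is
  \<open>k + l\<close> or \<open>k + l + 1\<close>. So additivity holds up to \<open>2 / 2\<^sup>n\<close> for every \<open>n\<close>.
\<close>

lemma prob_add:
  assumes A: "A \<in> Ev" and B: "B \<in> Ev" and disj: "A \<inter> B = {}"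
  shows "prob_of X (A \<union> B) = prob_of X A + prob_of X B"
proof -
  have AB: "A \<union> B \<in> Ev"
    using A B by auto
  have bounds: "prob_of X A + prob_of X B - prob_of X (A \<union> B) \<le> 2 / 2 ^ n \<and>
      prob_of X (A \<union> B) - (prob_of X A + prob_of X B) \<le> 2 / 2 ^ n" for n
  proof -
    obtain k C where k: "copies (X n) k C" "C \<sqsubseteq> A" "\<And>D. copies (X n) (Suc k) D \<Longrightarrow> A \<sqsubset> D"
        "real k / 2 ^ n \<le> prob_of X A" "prob_of X A \<le> real (Suc k) / 2 ^ n"
      using level[OF A, of n] by blast
    obtain l D where l: "copies (X n) l D" "D \<sqsubseteq> B" "\<And>C. copies (X n) (Suc l) C \<Longrightarrow> B \<sqsubset> C"
        "real l / 2 ^ n \<le> prob_of X B" "prob_of X B \<le> real (Suc l) / 2 ^ n"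
      using level[OF B, of n] by blast
    obtain i E where i: "copies (X n) i E" "E \<sqsubseteq> A \<union> B" "\<And>C. copies (X n) (Suc i) C \<Longrightarrow> A \<union> B \<sqsubset> C"
        "real i / 2 ^ n \<le> prob_of X (A \<union> B)" "prob_of X (A \<union> B) \<le> real (Suc i) / 2 ^ n"
      using level[OF AB, of n] by blast
    have "k + l \<le> i"
    proof (rule ccontr)
      assume "\<not> k + l \<le> i"
      show False
      proof (cases "k + l \<le> 2 ^ n")
        case True
        then obtain F where "copies (X n) (k + l) F"
          using copies_exist by blast
        then obtain F1 F2 where F: "copies (X n) k F1" "copies (X n) l F2" "F1 \<inter> F2 = {}" "F1 \<union> F2 = F"
          using copies_split[of "X n" k l F] by blast
        have "F1 \<sqsubseteq> A" "F2 \<sqsubseteq> B"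
          using copies_le[OF F(1) k(1)] copies_le[OF F(2) l(1)] trans[of F1 C A] trans[of F2 D B]
            copies_event F k l A B unit by blast+
        then have "F \<sqsubseteq> A \<union> B"
          using sum_le[of F1 A F2 B] F A B disj copies_event by auto
        moreover have "copies (X n) (Suc i + (k + l - Suc i)) F"
          using \<open>copies (X n) (k + l) F\<close> \<open>\<not> k + l \<le> i\<close>
          by (metis le_add_diff_inverse not_less_eq_eq)
        then obtain G1 G2 where "copies (X n) (Suc i) G1" "G1 \<union> G2 = F"
          using copies_split[of "X n" "Suc i" _ F] by metis
        ultimately show False
          using i(3)[of G1] mono_trans[of F "A \<union> B" "A \<union> B" G1] AB copies_event
            \<open>copies (X n) (k + l) F\<close> by auto
      next
        \<comment> \<open>Then \<open>k + l\<close> disjoint copies do not fit into the space, but \<open>A\<close> and \<open>B\<close> do.\<close>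
        case False
        have "k \<le> 2 ^ n"
          using copies_bound[OF k(1)] .
        with False have "2 ^ n - k < l"
          by linarith
        have "copies (X n) (k + (2 ^ n - k)) UNIV"
          using copies_UNIV[OF X, of n] \<open>k \<le> 2 ^ n\<close> by simp
        then obtain F1 F2 where F: "copies (X n) k F1" "copies (X n) (2 ^ n - k) F2" "F1 \<inter> F2 = {}"
            "F1 \<union> F2 = UNIV"
          using copies_split by metis
        have "F2 \<sqsubset> D"
          using copies_less[OF F(2) l(1) \<open>2 ^ n - k < l\<close>] .
        then have "F2 \<sqsubset> B"
          using l trans[of D B F2] copies_event F B by blast
        moreover have "F1 \<sqsubseteq> A"
          using copies_le[OF F(1) k(1)] trans[of F1 C A] copies_event F k A unit by blast
        ultimately have "F2 \<union> F1 \<sqsubset> B \<union> A"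
          using F A B disj copies_event by (intro sum_less) auto
        then show False
          using F(4) mono[of "B \<union> A" UNIV] A B by (auto simp: Un_commute)
      qed
    qed
    moreover have "i \<le> Suc (k + l)"
    proof (rule ccontr)
      assume "\<not> i \<le> Suc (k + l)"
      then have "copies (X n) (Suc k + (i - Suc k)) E"
        using i by simp
      then obtain F1 F' where F1: "copies (X n) (Suc k) F1" "copies (X n) (i - Suc k) F'" "F1 \<inter> F' = {}"
          "F1 \<union> F' = E"
        by (rule copies_split)
      have "copies (X n) (Suc l + (i - Suc k - Suc l)) F'"
        using F1(2) \<open>\<not> i \<le> Suc (k + l)\<close> le_add_diff_inverse[of "Suc l" "i - Suc k"] by simp
      then obtain F2 F'' where F2: "copies (X n) (Suc l) F2" "F2 \<union> F'' = F'"
        by (rule copies_split)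
      have "A \<union> B \<sqsubset> F1 \<union> F2"
        using k(3)[OF F1(1)] l(3)[OF F2(1)] lt_le[of B F2] F1 F2 A B copies_event
        by (intro sum_less) auto
      moreover have "F1 \<union> F2 \<sqsubseteq> A \<union> B"
        using mono_trans[of E "A \<union> B" "A \<union> B" "F1 \<union> F2"] i(1,2) F1 F2 AB copies_event by blast
      ultimately show False
        by blast
    qed
    ultimately have "real (k + l) / 2 ^ n \<le> real i / 2 ^ n" "real i / 2 ^ n \<le> real (Suc (k + l)) / 2 ^ n"
      by (auto intro!: divide_right_mono)
    then show ?thesis
      using k(4,5) l(4,5) i(4,5) by (simp add: add_divide_distrib)
  qed
  then have "prob_of X A + prob_of X B - prob_of X (A \<union> B) \<le> 0"
      "prob_of X (A \<union> B) - (prob_of X A + prob_of X B) \<le> 0"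
    using dyadic_zero by blast+
  then show ?thesis
    by simp
qed

lemma prob_UNIV: "prob_of X UNIV = 1"
proof (rule antisym)
  show "prob_of X UNIV \<le> 1"
    unfolding prob_of_def using grid_bound zero_in_grid[of UNIV] by (intro cSup_least) auto
  have "real 1 / 2 ^ 0 \<in> grid X UNIV"
    unfolding grid_def using copies_UNIV[OF X, of 0] refl[of UNIV]
    by (intro CollectI exI[of _ "1::nat"] exI[of _ "0::nat"]) auto
  then show "1 \<le> prob_of X UNIV"
    using prob_upper by fastforce
qed

lemma prob_of_fa_prob: "fa_prob Ev (prob_of X)"
  using prob_add prob_UNIV prob_upper zero_in_grid by (auto simp: fa_prob_def additive_def)

interpretation prob: fa_probability Ev "prob_of X"
  by unfold_locales (rule prob_of_fa_prob)

lemma prob_pos: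
  assumes A: "A \<in> Ev" "{} \<sqsubset> A"
  shows "0 < prob_of X A"
proof -
  obtain n where "X n \<sqsubset> A"
    using halving_small[OF X_halving A] by blast
  moreover have "copies (X n) (Suc 0) ({} \<union> X n)"
    using unit by (intro copies.intros) (auto intro: refl)
  ultimately have "real 1 / 2 ^ n \<in> grid X A"
    unfolding grid_def using lt_le[OF unit(1) A(1)] by force
  then have "1 / 2 ^ n \<le> prob_of X A"
    using prob_upper by fastforce
  then show ?thesis
    by (rule less_le_trans[rotated]) simp
qed

lemma prob_represents:
  assumes A: "A \<in> Ev" and B: "B \<in> Ev"
  shows "A \<sqsubseteq> B \<longleftrightarrow> prob_of X A \<le> prob_of X B"
proof
  show "prob_of X A \<le> prob_of X B" if "A \<sqsubseteq> B"
    using prob_mono[OF A B that] .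
  show "A \<sqsubseteq> B" if le: "prob_of X A \<le> prob_of X B"
  proof (rule ccontr)
    assume "B \<sqsubset> A"
    then obtain D where D: "D \<in> Ev" "B \<inter> D = {}" "{} \<sqsubset> D" "B \<union> D \<sqsubset> A"
      using gap[OF B A] by blast
    have "prob_of X B + prob_of X D \<le> prob_of X A"
      using prob_add[OF B D(1,2)] prob_mono[of "B \<union> D" A] lt_le[of "B \<union> D" A] A B D by auto
    then show False
      using prob_pos[OF D(1,3)] le by simp
  qed
qed

text \<open>
  The squeeze is now applied to the property of having at most the desired probability. Here its
  error bound gives equality at once, since the events \<open>X n\<close> have probabilities tending to \<open>0\<close>.
\<close>

lemma prob_convex: "convex_valued Ev (prob_of X)"
  unfolding convex_valued_def
proof (intro ballI)
  fix B and l :: real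
  assume B: "B \<in> Ev" and l: "l \<in> {0..1}"
  let ?P = "prob_of X"
  show "\<exists>A\<in>Ev. A \<subseteq> B \<and> ?P A = l * ?P B"
  proof (cases "?P B \<le> l * ?P B")
    case True
    moreover have "l * ?P B \<le> ?P B"
      using l prob.nonneg[OF B] by (simp add: mult_left_le_one_le)
    ultimately show ?thesis
      using B by auto
  next
    case False
    moreover have "?P {} \<le> l * ?P B"
      using l prob.nonneg[OF B] prob.empty_eq_0 by simp
    ultimately obtain A L H where A: "A \<in> Ev" "A \<subseteq> B"
      and ev: "\<And>n. L n \<in> Ev" "\<And>n. H n \<in> Ev" and sub: "\<And>n. L n \<subseteq> A" "\<And>n. A \<subseteq> H n"
      and low: "\<And>n. ?P (L n) \<le> l * ?P B" and high: "\<And>n. \<not> ?P (H n) \<le> l * ?P B"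
      and gap: "\<And>n. H n - L n \<sqsubseteq> X n"
      using squeeze[OF X_halving B, of "\<lambda>A. ?P A \<le> l * ?P B"] by metis
    have small: "?P (X n) \<le> 1 / 2 ^ n" for n
    proof (induction n)
      case 0
      then show ?case using prob.le_1 unit by simp
    next
      case (Suc n)
      have "?P (X (Suc n)) \<le> ?P (X n) - ?P (X (Suc n))"
        using X_halving prob_mono[of "X (Suc n)" "X n - X (Suc n)"] prob.diff[of "X n" "X (Suc n)"] unit
        by (auto simp: halving_def)
      then show ?case
        using Suc by simp
    qed
    have "?P A - l * ?P B \<le> 1 / 2 ^ n \<and> l * ?P B - ?P A \<le> 1 / 2 ^ n" for n
    proof -
      have "L n \<subseteq> H n"
        using sub(1)[of n] sub(2)[of n] by blast
      then have "?P (H n) - ?P (L n) \<le> 1 / 2 ^ n"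
        using prob_mono[OF Diff[OF ev(2,1)] unit(1) gap[of n]] small[of n] ev prob.diff[of "H n" "L n"]
        by simp
      moreover have "?P (L n) \<le> ?P A" "?P A \<le> ?P (H n)"
        using prob.mono[OF ev(1) A(1) sub(1)] prob.mono[OF A(1) ev(2) sub(2)] by auto
      ultimately show ?thesis
        using low[of n] high[of n] by linarith
    qed
    then have "?P A - l * ?P B \<le> 0" "l * ?P B - ?P A \<le> 0"
      using dyadic_zero by blast+
    then have "?P A = l * ?P B"
      by linarith
    then show ?thesis
      using A by auto
  qed
qed

end

theorem representing_probability:
  obtains P where "fa_prob Ev P" "convex_valued Ev P" "\<And>A B. A \<in> Ev \<Longrightarrow> B \<in> Ev \<Longrightarrow> A \<sqsubseteq> B \<longleftrightarrow> P A \<le> P B"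
proof -
  obtain X where X: "bisecting X"
    using bisecting_exists ..
  show ?thesis
    by (rule that[OF prob_of_fa_prob[OF X] prob_convex[OF X] prob_represents[OF X]])
qed

end

section \<open>Savage preferences\<close>

text \<open>
  Savage's postulates for acts with finitely many outcomes. The axiom \<open>eventwise_mono\<close> is the half
  of his third postulate that concerns weak preference, and \<open>small_events\<close> speaks of finite covers
  of the state space as \<open>fine\<close> does above.
\<close>

locale savage = sigma_algebra UNIV Ev for Ev :: "'s set set" +
  fixes Q :: "('s, 'o) act \<Rightarrow> ('s, 'o) act \<Rightarrow> bool" (infix "\<succeq>" 50)
  assumes weak_order: "weak_order_on (acts Ev) Q"
    and sure_thing: "B \<in> Ev \<Longrightarrow> f \<in> acts Ev \<Longrightarrow> g \<in> acts Ev \<Longrightarrow> h \<in> acts Ev \<Longrightarrow> h' \<in> acts Ev \<Longrightarrow>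
      paste f B h \<succeq> paste g B h \<Longrightarrow> paste f B h' \<succeq> paste g B h'"
    and eventwise_mono: "B \<in> Ev \<Longrightarrow> h \<in> acts Ev \<Longrightarrow> (\<lambda>_. x) \<succeq> (\<lambda>_. y) \<Longrightarrow>
      paste (\<lambda>_. x) B h \<succeq> paste (\<lambda>_. y) B h"
    and stakes_irrelevant: "A \<in> Ev \<Longrightarrow> B \<in> Ev \<Longrightarrow>
      strict Q (\<lambda>_. x) (\<lambda>_. x') \<Longrightarrow> strict Q (\<lambda>_. y) (\<lambda>_. y') \<Longrightarrow>
      paste (\<lambda>_. x) A (\<lambda>_. x') \<succeq> paste (\<lambda>_. x) B (\<lambda>_. x') \<Longrightarrow>
      paste (\<lambda>_. y) A (\<lambda>_. y') \<succeq> paste (\<lambda>_. y) B (\<lambda>_. y')"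
    and nontrivial: "\<exists>x y. strict Q (\<lambda>_. x) (\<lambda>_. y)"
    and small_events: "f \<in> acts Ev \<Longrightarrow> g \<in> acts Ev \<Longrightarrow> strict Q f g \<Longrightarrow>
      \<exists>\<P>. finite \<P> \<and> \<P> \<subseteq> Ev \<and> \<Union>\<P> = UNIV \<and>
        (\<forall>C\<in>\<P>. strict Q f (paste (\<lambda>_. x) C g) \<and> strict Q (paste (\<lambda>_. x) C f) g)"
begin

abbreviation indiff (infix "\<approx>" 50) where "f \<approx> g \<equiv> f \<succeq> g \<and> g \<succeq> f"
abbreviation bet :: "'o \<Rightarrow> 'o \<Rightarrow> 's set \<Rightarrow> ('s, 'o) act" where
  "bet x y A \<equiv> paste (\<lambda>_. x) A (\<lambda>_. y)"
abbreviation pref where "pref x y \<equiv> (\<lambda>_. x) \<succeq> (\<lambda>_. y)"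

lemma const_act: "(\<lambda>_. x :: 'o) \<in> acts Ev"
  by (rule acts_const[OF sigma_algebra_axioms])

lemma paste_act: "f \<in> acts Ev \<Longrightarrow> g \<in> acts Ev \<Longrightarrow> A \<in> Ev \<Longrightarrow> paste f A (g :: ('s, 'o) act) \<in> acts Ev"
  by (rule acts_paste[OF sigma_algebra_axioms])

lemma total: "f \<in> acts Ev \<Longrightarrow> g \<in> acts Ev \<Longrightarrow> f \<succeq> g \<or> g \<succeq> f"
  using weak_order by (auto simp: weak_order_on_def)

lemma trans: "f \<in> acts Ev \<Longrightarrow> g \<in> acts Ev \<Longrightarrow> h \<in> acts Ev \<Longrightarrow> f \<succeq> g \<Longrightarrow> g \<succeq> h \<Longrightarrow> f \<succeq> h"
  using weak_order transp_onD[of "acts Ev" Q f g h] by (simp add: weak_order_on_def)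

lemma refl: "f \<in> acts Ev \<Longrightarrow> f \<succeq> f"
  using total by blast

lemma pref_trans: "pref x y \<Longrightarrow> pref y z \<Longrightarrow> pref x z"
  using trans[OF const_act const_act const_act] .

lemma sure_indiff:
  assumes "B \<in> Ev" "f \<in> acts Ev" "g \<in> acts Ev" "h \<in> acts Ev" "h' \<in> acts Ev"
    and "paste f B h \<approx> paste g B h"
  shows "paste f B h' \<approx> paste g B h'"
  using sure_thing[OF assms(1,2,3,4,5)] sure_thing[OF assms(1,3,2,4,5)] assms(6) by simp

lemma paste_same: "paste f A f = (f :: ('s, 'o) act)"
  by (simp add: paste_def)

text \<open>
  Adding a disjoint event \<open>C\<close> to both sides of a comparison replaces the common payoff \<open>y\<close> on \<open>C\<close> by
  \<open>x\<close>, so additivity is an instance of the sure-thing principle.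
\<close>

lemma qualitative_probability_of_bets:
  assumes xy: "strict Q (\<lambda>_. x) (\<lambda>_. y)"
  shows "qualitative_probability Ev (\<lambda>A B. bet x y B \<succeq> bet x y A)"
proof unfold_locales
  have bet: "bet x y A \<in> acts Ev" if "A \<in> Ev" for A
    by (intro paste_act const_act that)
  have 0: "bet x y {} = (\<lambda>_. y)" and 1: "bet x y UNIV = (\<lambda>_. x)"
    by (auto simp: paste_def)
  show "bet x y B \<succeq> bet x y A \<or> bet x y A \<succeq> bet x y B" if "A \<in> Ev" "B \<in> Ev" for A B
    using total[OF bet[OF that(2)] bet[OF that(1)]] .
  show "bet x y C \<succeq> bet x y A" if "A \<in> Ev" "B \<in> Ev" "C \<in> Ev" "bet x y B \<succeq> bet x y A" "bet x y C \<succeq> bet x y B"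
    for A B C
    using trans[OF bet[OF that(3)] bet[OF that(2)] bet[OF that(1)] that(5,4)] .
  show "bet x y A \<succeq> bet x y {}" if "A \<in> Ev" for A
    using eventwise_mono[OF that const_act[of y], of x y] xy by (simp add: 0 paste_same strict_def)
  show "\<not> bet x y {} \<succeq> bet x y UNIV"
    using xy by (simp add: 0 1 strict_def)
  show "(bet x y (B \<union> C) \<succeq> bet x y (A \<union> C)) = (bet x y B \<succeq> bet x y A)"
    if "A \<in> Ev" "B \<in> Ev" "C \<in> Ev" "A \<inter> C = {}" "B \<inter> C = {}" for A B C
  proof -
    have *: "bet x y A = paste (bet x y A) (UNIV - C) (\<lambda>_. y)"
        "bet x y (A \<union> C) = paste (bet x y A) (UNIV - C) (\<lambda>_. x)" if "A \<inter> C = {}" for A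
      using that by (auto simp: paste_def fun_eq_iff)
    have "paste (bet x y B) (UNIV - C) (\<lambda>_. x) \<succeq> paste (bet x y A) (UNIV - C) (\<lambda>_. x) \<longleftrightarrow>
        paste (bet x y B) (UNIV - C) (\<lambda>_. y) \<succeq> paste (bet x y A) (UNIV - C) (\<lambda>_. y)"
      using sure_thing[OF _ bet bet const_act const_act] that by blast
    then show ?thesis
      unfolding *[OF that(4), symmetric] *[OF that(5), symmetric] .
  qed
  show "\<exists>\<P>. finite \<P> \<and> \<P> \<subseteq> Ev \<and> \<Union>\<P> = UNIV \<and> (\<forall>C\<in>\<P>. \<not> bet x y (A \<union> C) \<succeq> bet x y B)"
    if AB: "A \<in> Ev" "B \<in> Ev" "\<not> bet x y A \<succeq> bet x y B" for A B
  proof -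
    have "strict Q (bet x y B) (bet x y A)"
      using AB total[OF bet[OF AB(1)] bet[OF AB(2)]] by (auto simp: strict_def)
    then obtain \<P> where "finite \<P>" "\<P> \<subseteq> Ev" "\<Union>\<P> = UNIV"
      "\<And>C. C \<in> \<P> \<Longrightarrow> strict Q (bet x y B) (paste (\<lambda>_. x) C (bet x y A))"
      using small_events[of "bet x y B" "bet x y A" x] AB bet by blast
    moreover have "paste (\<lambda>_. x) C (bet x y A) = bet x y (A \<union> C)" for C
      by (auto simp: paste_def)
    ultimately show ?thesis
      by (intro exI[of _ \<P>]) (simp add: strict_def)
  qed
qed

lemma belief:
  obtains P where "convex_probability Ev P"
    "\<And>x y A B. strict Q (\<lambda>_. x) (\<lambda>_. y) \<Longrightarrow> A \<in> Ev \<Longrightarrow> B \<in> Ev \<Longrightarrow>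
      bet x y A \<succeq> bet x y B \<longleftrightarrow> P B \<le> P A"
proof -
  obtain x0 y0 where 0: "strict Q (\<lambda>_. x0) (\<lambda>_. y0)"
    using nontrivial by blast
  interpret bets: qualitative_probability Ev "\<lambda>A B. bet x0 y0 B \<succeq> bet x0 y0 A"
    by (rule qualitative_probability_of_bets[OF 0])
  obtain P where P: "fa_prob Ev P" "convex_valued Ev P"
    "\<And>A B. A \<in> Ev \<Longrightarrow> B \<in> Ev \<Longrightarrow> bet x0 y0 B \<succeq> bet x0 y0 A \<longleftrightarrow> P A \<le> P B"
    using bets.representing_probability by blast
  have "convex_probability Ev P"
    by unfold_locales (fact P)+
  then show ?thesis
  proof (rule that)
    fix x y A B
    assume xy: "strict Q (\<lambda>_. x) (\<lambda>_. y)" and ev: "A \<in> Ev" "B \<in> Ev"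
    show "bet x y A \<succeq> bet x y B \<longleftrightarrow> P B \<le> P A"
      using stakes_irrelevant[OF ev 0 xy] stakes_irrelevant[OF ev xy 0] P(3)[OF ev(2,1)] by blast
  qed
qed

end

section \<open>Utility by calibration against bets\<close>

locale savage_belief = savage Ev Q + convex_probability Ev P
  for Ev :: "'s set set" and Q :: "('s, 'o) act \<Rightarrow> ('s, 'o) act \<Rightarrow> bool" (infix "\<succeq>" 50) and P +
  assumes bets: "strict Q (\<lambda>_. x) (\<lambda>_. y) \<Longrightarrow> A \<in> Ev \<Longrightarrow> B \<in> Ev \<Longrightarrow>
      bet x y A \<succeq> bet x y B \<longleftrightarrow> P B \<le> P A"
begin

lemma bet_act: "A \<in> Ev \<Longrightarrow> bet x y A \<in> acts Ev"
  by (intro paste_act const_act)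

text \<open>
  The probability of \<open>C\<close> is the supremum of the probabilities of those winning events inside \<open>A\<close>
  whose bets are no better than \<open>g\<close>. A strict preference in either direction would survive a small
  change of the winning event, which contradicts the choice.
\<close>

lemma matching_bet:
  assumes xy: "strict Q (\<lambda>_. x) (\<lambda>_. y)" and A: "A \<in> Ev" and g: "g \<in> acts Ev"
    and lo: "g \<succeq> (\<lambda>_. y)" and hi: "bet x y A \<succeq> g"
  obtains C where "C \<in> Ev" "C \<subseteq> A" "bet x y C \<approx> g"
proof -
  have 0: "bet x y {} = (\<lambda>_. y)"
    by (auto simp: paste_def)
  define T where "T = {P C | C. C \<in> Ev \<and> C \<subseteq> A \<and> g \<succeq> bet x y C}"
  have T0: "0 \<in> T"
    unfolding T_def using lo 0 empty_eq_0 empty_sets by (intro CollectI exI[of _ "{}"]) auto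
  have T1: "p \<le> P A" if "p \<in> T" for p
    using that mono A by (auto simp: T_def)
  then have bdd: "bdd_above T"
    by (auto simp: bdd_above_def)
  have "0 \<le> Sup T" "Sup T \<le> P A"
    using cSup_upper[OF T0 bdd] cSup_least[of T "P A"] T0 T1 by auto
  then obtain C where C: "C \<in> Ev" "C \<subseteq> A" "P C = Sup T"
    using subevent[OF A] by blast
  have "\<not> strict Q (bet x y C) g"
  proof
    assume less: "strict Q (bet x y C) g"
    obtain \<P> where "finite \<P> \<and> \<P> \<subseteq> Ev \<and> \<Union>\<P> = UNIV \<and>
        (\<forall>D\<in>\<P>. strict Q (bet x y C) (paste (\<lambda>_. y) D g) \<and> strict Q (paste (\<lambda>_. y) D (bet x y C)) g)"
      using small_events[OF bet_act[OF C(1)] g less] ..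
    then have \<P>: "finite \<P>" "\<P> \<subseteq> Ev" "\<Union>\<P> = UNIV"
        "\<And>D. D \<in> \<P> \<Longrightarrow> strict Q (paste (\<lambda>_. y) D (bet x y C)) g"
      by simp_all
    have "\<exists>D\<in>\<P>. P (C \<inter> D) \<noteq> 0"
    proof (rule ccontr)
      assume "\<not> ?thesis"
      then have "P C = 0"
        using null_cover[of \<P> C] \<P> C by auto
      then have "(\<lambda>_. y) \<succeq> bet x y C"
        using bets[OF xy, of "{}" C] C 0 empty_eq_0 by simp
      then show False
        using trans[OF g const_act bet_act[OF C(1)] lo] less by (simp add: strict_def)
    qed
    then obtain D where D: "D \<in> \<P>" "P (C \<inter> D) \<noteq> 0"
      by blast
    have ev: "C \<inter> D \<in> Ev" "C - D \<in> Ev" "(C - D) \<inter> (C \<inter> D) = {}" "(C - D) \<union> (C \<inter> D) = C"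
      using C D \<P> by auto
    \<comment> \<open>The bet on \<open>C - D\<close> is still better than \<open>g\<close>, but its probability is below the supremum.\<close>
    have "P (C - D) < Sup T"
      using add[OF ev(2,1,3)] nonneg[OF ev(1)] D ev(4) C(3) by simp
    then obtain p where "p \<in> T" "P (C - D) < p"
      using T0 by (metis less_cSupE empty_iff)
    then obtain C' where C': "C' \<in> Ev" "C' \<subseteq> A" "g \<succeq> bet x y C'" "P (C - D) < P C'"
      unfolding T_def by blast
    have "bet x y C' \<succeq> bet x y (C - D)"
      using bets[OF xy C'(1) ev(2)] C'(4) by simp
    then have "g \<succeq> bet x y (C - D)"
      using trans[OF g bet_act[OF C'(1)] bet_act[OF ev(2)] C'(3)] by blast
    moreover have "paste (\<lambda>_. y) D (bet x y C) = bet x y (C - D)"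
      by (auto simp: paste_def)
    ultimately show False
      using \<P>(4)[OF D(1)] by (simp add: strict_def)
  qed
  moreover have "\<not> strict Q g (bet x y C)"
  proof
    assume less: "strict Q g (bet x y C)"
    obtain \<P> where "finite \<P> \<and> \<P> \<subseteq> Ev \<and> \<Union>\<P> = UNIV \<and>
        (\<forall>D\<in>\<P>. strict Q g (paste (\<lambda>_. x) D (bet x y C)) \<and> strict Q (paste (\<lambda>_. x) D g) (bet x y C))"
      using small_events[OF g bet_act[OF C(1)] less] ..
    then have \<P>: "finite \<P>" "\<P> \<subseteq> Ev" "\<Union>\<P> = UNIV"
        "\<And>D. D \<in> \<P> \<Longrightarrow> strict Q g (paste (\<lambda>_. x) D (bet x y C))"
      by simp_all
    have "\<exists>D\<in>\<P>. P ((A - C) \<inter> D) \<noteq> 0"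
    proof (rule ccontr)
      assume "\<not> ?thesis"
      then have "P (A - C) = 0"
        using null_cover[of \<P> "A - C"] \<P> C A by auto
      then have "P A \<le> P C"
        using diff[OF A C(1,2)] by simp
      then have "bet x y C \<succeq> bet x y A"
        using bets[OF xy C(1) A] by simp
      then have "bet x y C \<succeq> g"
        using trans[OF bet_act[OF C(1)] bet_act[OF A] g _ hi] by blast
      then show False
        using less by (simp add: strict_def)
    qed
    then obtain D where D: "D \<in> \<P>" "P ((A - C) \<inter> D) \<noteq> 0"
      by blast
    let ?D = "(A - C) \<inter> D"
    have ev: "?D \<in> Ev" "C \<union> ?D \<in> Ev" "C \<union> D \<in> Ev" "C \<inter> ?D = {}" "C \<union> ?D \<subseteq> A" "C \<union> ?D \<subseteq> C \<union> D"
      using A C D \<P> by auto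
    have "paste (\<lambda>_. x) D (bet x y C) = bet x y (C \<union> D)"
      by (auto simp: paste_def)
    then have "g \<succeq> bet x y (C \<union> D)"
      using \<P>(4)[OF D(1)] by (simp add: strict_def)
    moreover have "bet x y (C \<union> D) \<succeq> bet x y (C \<union> ?D)"
      using bets[OF xy ev(3,2)] mono[OF ev(2,3,6)] by simp
    ultimately have "g \<succeq> bet x y (C \<union> ?D)"
      using trans[OF g bet_act[OF ev(3)] bet_act[OF ev(2)]] by blast
    then have "P (C \<union> ?D) \<in> T"
      using ev by (auto simp: T_def)
    then have "P (C \<union> ?D) \<le> P C"
      using cSup_upper[OF _ bdd] C(3) by simp
    then show False
      using add[OF C(1) ev(1,4)] nonneg[OF ev(1)] D(2) by simp
  qed
  ultimately have "bet x y C \<approx> g"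
    using total[OF bet_act[OF C(1)] g] by (auto simp: strict_def)
  then show ?thesis
    using that C by blast
qed

text \<open>
  Calibration of \<open>f\<close> on \<open>A\<close>: as long as the payoff outside \<open>A\<close> is kept, \<open>f\<close> may be replaced on \<open>A\<close> by the
  bet that pays \<open>x\<close> on \<open>C\<close> and \<open>y\<close> on \<open>A - C\<close>. The payoff \<open>y\<close> outside \<open>A\<close> is one choice among many; by
  the sure-thing principle all of them are equivalent.
\<close>

definition matched :: "'o \<Rightarrow> 'o \<Rightarrow> ('s, 'o) act \<Rightarrow> 's set \<Rightarrow> 's set \<Rightarrow> bool" where
  "matched x y f A C \<longleftrightarrow> C \<in> Ev \<and> C \<subseteq> A \<and> paste f A (\<lambda>_. y) \<approx> bet x y C"

lemma indiff_trans:
  "f \<in> acts Ev \<Longrightarrow> g \<in> acts Ev \<Longrightarrow> h \<in> acts Ev \<Longrightarrow> f \<approx> g \<Longrightarrow> g \<approx> h \<Longrightarrow> f \<approx> h"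
  using trans[of f g h] trans[of h g f] by simp

lemma matched_paste:
  assumes f: "f \<in> acts Ev" and h: "h \<in> acts Ev" and A: "A \<in> Ev" and m: "matched x y f A C"
  shows "paste f A h \<approx> paste (bet x y C) A h"
proof (rule sure_indiff[OF A f _ const_act h])
  show "bet x y C \<in> acts Ev"
    using m bet_act by (simp add: matched_def)
  have "paste (bet x y C) A (\<lambda>_. y) = bet x y C"
    using m by (auto simp: matched_def paste_def fun_eq_iff)
  then show "paste f A (\<lambda>_. y) \<approx> paste (bet x y C) A (\<lambda>_. y)"
    using m by (simp add: matched_def)
qed

lemma matched_Un:
  assumes f: "f \<in> acts Ev" and ev: "A1 \<in> Ev" "A2 \<in> Ev" and disj: "A1 \<inter> A2 = {}"
    and m1: "matched x y f A1 C1" and m2: "matched x y f A2 C2"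
  shows "matched x y f (A1 \<union> A2) (C1 \<union> C2)"
proof -
  have C: "C1 \<in> Ev" "C1 \<subseteq> A1" "C2 \<in> Ev" "C2 \<subseteq> A2"
    using m1 m2 by (auto simp: matched_def)
  let ?y = "\<lambda>_. y" and ?b = "bet x y C2"
  have 1: "paste f A1 ?b \<approx> paste (bet x y C1) A1 ?b"
    using C f ev m1 bet_act by (intro matched_paste) auto
  have 2: "paste f A2 (paste f A1 ?y) \<approx> paste ?b A2 (paste f A1 ?y)"
    using f ev m2 by (intro matched_paste paste_act const_act)
  have e1: "paste f A2 (paste f A1 ?y) = paste f (A1 \<union> A2) ?y"
    by (auto simp: paste_def)
  have e2: "paste ?b A2 (paste f A1 ?y) = paste f A1 ?b"
    using C disj by (auto simp: paste_def fun_eq_iff)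
  have e3: "paste (bet x y C1) A1 ?b = bet x y (C1 \<union> C2)"
    using C disj by (auto simp: paste_def fun_eq_iff)
  have "paste f (A1 \<union> A2) ?y \<approx> bet x y (C1 \<union> C2)"
    using 2 1 unfolding e1 e2 e3
    by (rule indiff_trans[rotated 3]) (use f ev C in \<open>auto intro!: paste_act const_act\<close>)
  then show ?thesis
    using C by (auto simp: matched_def)
qed

lemma bet_cong:
  assumes ev: "A \<in> Ev" "B \<in> Ev" and P: "P A = P B" and pq: "pref p q"
  shows "bet p q A \<approx> bet p q B"
proof (cases "pref q p")
  case False
  then have "strict Q (\<lambda>_. p) (\<lambda>_. q)"
    using pq by (simp add: strict_def)
  then show ?thesis
    using bets ev P by simp
next
  case True
  have "bet p q C \<approx> (\<lambda>_. q)" if "C \<in> Ev" for C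
    using eventwise_mono[OF that const_act pq, of q] eventwise_mono[OF that const_act True, of q]
    by (simp add: paste_same)
  from this[OF ev(1)] this[OF ev(2)] show ?thesis
    using indiff_trans[OF bet_act[OF ev(1), of p q] const_act bet_act[OF ev(2), of p q], of q] by simp
qed

text \<open>
  The payoff outside \<open>A \<union> B\<close> may be taken to be \<open>q\<close>; then both acts are bets of \<open>p\<close> against \<open>q\<close> on
  equally likely events.
\<close>

lemma swap:
  assumes ev: "A \<in> Ev" "B \<in> Ev" and disj: "A \<inter> B = {}" and P: "P A = P B" and h: "h \<in> acts Ev"
  shows "paste (\<lambda>_. p) A (paste (\<lambda>_. q) B h) \<approx> paste (\<lambda>_. q) A (paste (\<lambda>_. p) B h)"
proof -
  have *: "paste (\<lambda>_. p) A (paste (\<lambda>_. q) B h) \<approx> paste (\<lambda>_. q) A (paste (\<lambda>_. p) B h)"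
    if ev: "A \<in> Ev" "B \<in> Ev" and disj: "A \<inter> B = {}" and P: "P A = P B" and pq: "pref p q" for A B p q
  proof -
    have "paste (bet p q A) (A \<union> B) (\<lambda>_. q) = bet p q A" "paste (bet p q B) (A \<union> B) (\<lambda>_. q) = bet p q B"
      by (auto simp: paste_def)
    then have "paste (bet p q A) (A \<union> B) h \<approx> paste (bet p q B) (A \<union> B) h"
      using sure_indiff[OF Un[OF ev] bet_act[OF ev(1), of p q] bet_act[OF ev(2), of p q] const_act h, of q]
        bet_cong[OF ev P pq] by simp
    moreover have "paste (bet p q A) (A \<union> B) h = paste (\<lambda>_. p) A (paste (\<lambda>_. q) B h)"
      by (auto simp: paste_def)
    moreover have "paste (bet p q B) (A \<union> B) h = paste (\<lambda>_. q) A (paste (\<lambda>_. p) B h)"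
      using disj by (auto simp: paste_def fun_eq_iff)
    ultimately show ?thesis
      by simp
  qed
  show ?thesis
  proof (cases "pref p q")
    case True
    show ?thesis
      by (rule *[OF ev disj P True])
  next
    case False
    then have "pref q p"
      using total[OF const_act const_act, of p q] by simp
    moreover have "paste (\<lambda>_. r) B (paste (\<lambda>_. t) A h) = paste (\<lambda>_. t) A (paste (\<lambda>_. r) B h)" for r t
      using disj by (auto simp: paste_def fun_eq_iff)
    ultimately show ?thesis
      using *[OF ev(2,1) _ P[symmetric], of q p] disj by (simp add: Int_commute)
  qed
qed

text \<open>
  Choose \<open>C' \<subseteq> A'\<close> as likely as \<open>C\<close>, so that also \<open>A' - C'\<close> is as likely as \<open>A - C\<close>. Exchanging
  payoffs between \<open>C\<close> and \<open>C'\<close> and between \<open>A - C\<close> and \<open>A' - C'\<close> moves the constant payoff \<open>z\<close> from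
  \<open>A\<close> to \<open>A'\<close> and the bet from \<open>A'\<close> to \<open>A\<close>. As the bet on \<open>A\<close> is as good as \<open>z\<close> there, the payoff on
  \<open>A\<close> cancels and the same holds on \<open>A'\<close>.
\<close>

lemma matched_transfer:
  assumes ev: "A \<in> Ev" "A' \<in> Ev" and disj: "A \<inter> A' = {}" and P: "P A = P A'"
    and m: "matched x y (\<lambda>_. z) A C"
  obtains C' where "matched x y (\<lambda>_. z) A' C'" "P C' = P C"
proof -
  have C: "C \<in> Ev" "C \<subseteq> A"
    using m by (auto simp: matched_def)
  then obtain C' where C': "C' \<in> Ev" "C' \<subseteq> A'" "P C' = P C"
    using subevent[OF ev(2), of "P C"] mono[OF C(1) ev(1)] nonneg P by metis
  have D: "A - C \<in> Ev" "A' - C' \<in> Ev" "P (A - C) = P (A' - C')"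
    using ev C C' diff P by auto
  let ?x = "\<lambda>_. x" and ?y = "\<lambda>_. y" and ?z = "\<lambda>_. z"
  let ?f0 = "paste ?z A (bet x y C')" and ?f2 = "paste ?z A' (bet x y C)"
  let ?f1 = "paste ?z (A - C) (paste ?y (A' - C') (paste ?x C (paste ?z C' ?y)))"
  have acts: "?f0 \<in> acts Ev" "?f1 \<in> acts Ev" "?f2 \<in> acts Ev" "bet x y (C \<union> C') \<in> acts Ev"
    using ev C C' D by (auto intro!: paste_act const_act)
  have "?f0 = paste ?z C (paste ?x C' (paste ?z (A - C) (paste ?y (A' - C') ?y)))"
    using C C' disj by (auto simp: paste_def fun_eq_iff)
  moreover have "?f1 = paste ?x C (paste ?z C' (paste ?z (A - C) (paste ?y (A' - C') ?y)))"
    using C C' disj by (auto simp: paste_def fun_eq_iff)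
  moreover have "paste ?z C (paste ?x C' h) \<approx> paste ?x C (paste ?z C' h)" if "h \<in> acts Ev" for h
    using that C C' disj by (intro swap) auto
  ultimately have "?f0 \<approx> ?f1"
    using D by (simp add: paste_act const_act)
  have "?f2 = paste ?y (A - C) (paste ?z (A' - C') (paste ?x C (paste ?z C' ?y)))"
    using C C' disj by (auto simp: paste_def fun_eq_iff)
  moreover have "?f1 \<approx> paste ?y (A - C) (paste ?z (A' - C') (paste ?x C (paste ?z C' ?y)))"
    using D C C' disj by (intro swap) (auto intro!: paste_act const_act)
  ultimately have "?f1 \<approx> ?f2"
    by simp
  have "?f0 \<approx> paste (bet x y C) A (bet x y C')"
    using ev C' m by (intro matched_paste) (auto intro!: paste_act const_act)
  moreover have "paste (bet x y C) A (bet x y C') = bet x y (C \<union> C')"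
    using C C' disj by (auto simp: paste_def fun_eq_iff)
  ultimately have "?f0 \<approx> bet x y (C \<union> C')"
    by simp
  then have "?f2 \<approx> bet x y (C \<union> C')"
    using \<open>?f0 \<approx> ?f1\<close> \<open>?f1 \<approx> ?f2\<close> indiff_trans acts by meson
  moreover have "bet x y (C \<union> C') = paste (bet x y C') A' (bet x y C)"
    using C C' disj by (auto simp: paste_def fun_eq_iff)
  ultimately have "paste ?z A' ?y \<approx> paste (bet x y C') A' ?y"
    using sure_indiff[OF ev(2) const_act _ _ const_act, of "bet x y C'" "bet x y C" z y] C C' bet_act by simp
  moreover have "paste (bet x y C') A' ?y = bet x y C'"
    using C' by (auto simp: paste_def fun_eq_iff)
  ultimately have "matched x y ?z A' C'"
    using C' by (simp add: matched_def)
  then show ?thesis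
    using that C' by blast
qed

lemma matched_unique:
  assumes "strict Q (\<lambda>_. x) (\<lambda>_. y)" "f \<in> acts Ev" "A \<in> Ev" "matched x y f A C" "matched x y f A D"
  shows "P C = P D"
proof -
  have "C \<in> Ev" "D \<in> Ev"
    using assms by (auto simp: matched_def)
  moreover have "bet x y C \<approx> bet x y D"
    using assms(4,5) indiff_trans[of "bet x y C" "paste f A (\<lambda>_. y)" "bet x y D"]
      paste_act[OF assms(2) const_act assms(3)] bet_act calculation
    by (auto simp: matched_def)
  ultimately show ?thesis
    using bets[OF assms(1)] by (simp add: order_antisym)
qed

definition calibrated :: "'o \<Rightarrow> 'o \<Rightarrow> 'o \<Rightarrow> real \<Rightarrow> bool" where
  "calibrated x y z c \<longleftrightarrow> (\<forall>A\<in>Ev. \<exists>C. matched x y (\<lambda>_. z) A C \<and> P C = c * P A)"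

text \<open>
  The probability \<open>m A\<close> of the winning event that calibrates \<open>z\<close> on \<open>A\<close> is additive in \<open>A\<close> by
  \<open>matched_Un\<close> and equal on equally likely disjoint events by \<open>matched_transfer\<close>.
\<close>

lemma calibration:
  assumes xy: "strict Q (\<lambda>_. x) (\<lambda>_. y)" and z: "pref x z" "pref z y"
  shows "\<exists>c. calibrated x y z c"
proof -
  have ex: "\<exists>C. matched x y (\<lambda>_. z) A C" if A: "A \<in> Ev" for A
  proof -
    have "paste (\<lambda>_. z) A (\<lambda>_. y) \<succeq> (\<lambda>_. y)" "bet x y A \<succeq> paste (\<lambda>_. z) A (\<lambda>_. y)"
      using eventwise_mono[OF A const_act z(1), of y] eventwise_mono[OF A const_act z(2), of y]
      by (simp_all add: paste_same)
    then obtain C where "C \<in> Ev" "C \<subseteq> A" "bet x y C \<approx> paste (\<lambda>_. z) A (\<lambda>_. y)"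
      using matching_bet[OF xy A bet_act[OF A]] by metis
    then show ?thesis
      unfolding matched_def by blast
  qed
  define m where "m A = P (SOME C. matched x y (\<lambda>_. z) A C)" for A
  have m: "\<exists>C. matched x y (\<lambda>_. z) A C \<and> P C = m A" if "A \<in> Ev" for A
    using someI_ex[OF ex[OF that]] unfolding m_def by blast
  have m_eq: "m A = P C" if "A \<in> Ev" "matched x y (\<lambda>_. z) A C" for A C
    using m[OF that(1)] matched_unique[OF xy const_act that(1) _ that(2)] by auto
  have linear: "m A = m UNIV * P A" if "A \<in> Ev" for A
  proof (rule additive_function_linear[OF _ _ _ that])
    show "0 \<le> m A" if "A \<in> Ev" for A
      using m[OF that] nonneg unfolding matched_def by metis
    show "m (A \<union> B) = m A + m B" if AB: "A \<in> Ev" "B \<in> Ev" "A \<inter> B = {}" for A B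
    proof -
      obtain C D where C: "matched x y (\<lambda>_. z) A C" and D: "matched x y (\<lambda>_. z) B D"
        using ex[OF AB(1)] ex[OF AB(2)] by blast
      have "P (C \<union> D) = P C + P D"
        using C D AB by (intro add) (auto simp: matched_def)
      then show ?thesis
        using m_eq[OF Un[OF AB(1,2)] matched_Un[OF const_act AB C D]] m_eq[OF AB(1) C] m_eq[OF AB(2) D]
        by simp
    qed
    show "m A = m B" if AB: "A \<in> Ev" "B \<in> Ev" "A \<inter> B = {}" "P A = P B" for A B
    proof -
      obtain C where C: "matched x y (\<lambda>_. z) A C"
        using ex[OF AB(1)] ex[OF AB(2)] by blast
      obtain D where "matched x y (\<lambda>_. z) B D" "P D = P C"
        using matched_transfer[OF AB C] by blast
      then show ?thesis
        using m_eq AB C by simp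
    qed
  qed
  have "\<exists>C. matched x y (\<lambda>_. z) A C \<and> P C = m UNIV * P A" if "A \<in> Ev" for A
    using m[OF that] unfolding linear[OF that] .
  then show ?thesis
    unfolding calibrated_def by blast
qed

text \<open>
  The utility of \<open>z\<close> on the scale where \<open>x\<close> has utility \<open>1\<close> and \<open>y\<close> has utility \<open>0\<close>.
\<close>

definition cal :: "'o \<Rightarrow> 'o \<Rightarrow> 'o \<Rightarrow> real" where
  "cal x y z = (SOME c. calibrated x y z c)"

definition between :: "'o \<Rightarrow> 'o \<Rightarrow> 'o set" where
  "between x y = {z. pref x z \<and> pref z y}"

text \<open>
  Calibrate \<open>f\<close> on the events where it is constant and join the pieces with \<open>matched_Un\<close>.
\<close>

lemma equivalent_bet:
  assumes xy: "strict Q (\<lambda>_. x) (\<lambda>_. y)" and f: "f \<in> acts Ev" "range f \<subseteq> between x y"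
  obtains B where "B \<in> Ev" "f \<approx> bet x y B" "P B = exp_util (cal x y) P f"
proof -
  have "\<exists>B. matched x y f (f -` Z) B \<and> P B = (\<Sum>z\<in>Z. cal x y z * P (f -` {z}))"
    if "finite Z" "Z \<subseteq> range f" for Z
    using that
  proof induction
    case empty
    have "paste f {} (\<lambda>_. y) = bet x y {}"
      by (simp add: paste_def)
    then have "matched x y f {} {}"
      using refl[OF bet_act[of "{}"]] by (simp add: matched_def)
    then show ?case
      using empty_eq_0 by (intro exI[of _ "{}"]) simp
  next
    case (insert z Z)
    have ev: "f -` Z \<in> Ev" "f -` {z} \<in> Ev"
      using sum_vimage[OF f(1) insert.hyps(1)] f(1) by (simp_all add: acts_def)
    have "Z \<subseteq> range f" "z \<in> between x y"
      using insert.prems f(2) by auto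
    then obtain B where B: "matched x y f (f -` Z) B" "P B = (\<Sum>z\<in>Z. cal x y z * P (f -` {z}))"
      using insert.IH by blast
    have "calibrated x y z (cal x y z)"
      using someI_ex[OF calibration[OF xy, of z]] \<open>z \<in> between x y\<close> unfolding cal_def between_def
      by simp
    then obtain C where C: "matched x y (\<lambda>_. z) (f -` {z}) C" "P C = cal x y z * P (f -` {z})"
      using ev unfolding calibrated_def by blast
    have "paste f (f -` {z}) (\<lambda>_. y) = paste (\<lambda>_. z) (f -` {z}) (\<lambda>_. y)"
      by (auto simp: paste_def)
    then have C': "matched x y f (f -` {z}) C"
      using C(1) by (simp add: matched_def)
    have disj: "f -` {z} \<inter> f -` Z = {}"
      using insert.hyps by auto
    have "matched x y f (f -` {z} \<union> f -` Z) (C \<union> B)"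
      by (rule matched_Un[OF f(1) ev(2,1) disj C' B(1)])
    moreover have "P (C \<union> B) = P C + P B"
      using C' B disj by (intro add) (auto simp: matched_def)
    moreover have "f -` insert z Z = f -` {z} \<union> f -` Z"
      by auto
    ultimately show ?case
      using insert.hyps B(2) C(2) by auto
  qed
  from this[of "range f"] obtain B where "matched x y f (f -` range f) B" "P B = exp_util (cal x y) P f"
    using f(1) by (auto simp: acts_def exp_util_def)
  moreover have "paste f (f -` range f) (\<lambda>_. y) = f"
    by (auto simp: paste_def)
  ultimately show ?thesis
    using that[of B] by (simp add: matched_def)
qed

lemma interval_utility:
  assumes xy: "strict Q (\<lambda>_. x) (\<lambda>_. y)"
    and f: "f \<in> acts Ev" "range f \<subseteq> between x y" and g: "g \<in> acts Ev" "range g \<subseteq> between x y"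
  shows "f \<succeq> g \<longleftrightarrow> exp_util (cal x y) P g \<le> exp_util (cal x y) P f"
proof -
  obtain A where A: "A \<in> Ev" "f \<approx> bet x y A" "P A = exp_util (cal x y) P f"
    by (rule equivalent_bet[OF xy f])
  obtain B where B: "B \<in> Ev" "g \<approx> bet x y B" "P B = exp_util (cal x y) P g"
    by (rule equivalent_bet[OF xy g])
  note bA = bet_act[OF A(1), of x y] and bB = bet_act[OF B(1), of x y]
  have "f \<succeq> g \<longleftrightarrow> bet x y A \<succeq> bet x y B"
    using A(2) B(2) trans[OF bA f(1) g(1)] trans[OF bA g(1) bB] trans[OF f(1) bA bB]
      trans[OF f(1) bB g(1)] by blast
  then show ?thesis
    using bets[OF xy A(1) B(1)] A(3) B(3) by simp
qed

text \<open>
  The outcome \<open>w\<close> is as good as a bet on \<open>x\<close> against \<open>y\<close> that wins with probability \<open>cal x y w\<close>.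
  Evaluating both on the scale of the wider interval gives the change of scale.
\<close>

lemma cal_rescale:
  assumes XY: "strict Q (\<lambda>_. X) (\<lambda>_. Y)" and xy: "strict Q (\<lambda>_. x) (\<lambda>_. y)"
    and w: "w \<in> between x y" and outer: "pref X x" "pref y Y"
  shows "cal X Y w = cal X Y y + cal x y w * (cal X Y x - cal X Y y)"
proof -
  have "range (\<lambda>_::'s. w) \<subseteq> between x y"
    using w by auto
  then obtain B where B: "B \<in> Ev" "(\<lambda>_. w) \<approx> bet x y B" "P B = exp_util (cal x y) P (\<lambda>_. w)"
    by (rule equivalent_bet[OF xy const_act])
  have "pref X y" "pref x Y" "pref X w" "pref w Y" "pref x y"
    using xy w outer pref_trans[of X x y] pref_trans[of x y Y] pref_trans[of X x w] pref_trans[of w y Y]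
    by (auto simp: strict_def between_def)
  then have r: "range (bet x y B) \<subseteq> between X Y" "range (\<lambda>_::'s. w) \<subseteq> between X Y"
    using outer by (auto simp: between_def paste_def)
  then have "exp_util (cal X Y) P (\<lambda>_. w) = exp_util (cal X Y) P (bet x y B)"
    using interval_utility[OF XY const_act r(2) bet_act[OF B(1)] r(1)]
      interval_utility[OF XY bet_act[OF B(1)] r(1) const_act r(2)] B(2) by simp
  then show ?thesis
    using B(3) by (simp add: exp_util_const exp_util_bet[OF B(1)] algebra_simps)
qed

lemma best_outcome:
  assumes "finite Z" "Z \<noteq> {}"
  shows "\<exists>x\<in>Z. \<forall>z\<in>Z. pref x z"
  using assms
proof (induction rule: finite_ne_induct)
  case (singleton z)
  then show ?case using refl[OF const_act, of z] by simp
next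
  case (insert z Z)
  then obtain x where x: "x \<in> Z" "\<And>z. z \<in> Z \<Longrightarrow> pref x z"
    by blast
  show ?case
  proof (cases "pref x z")
    case True
    then show ?thesis using x by auto
  next
    case False
    then have "pref z x"
      using total[OF const_act const_act, of x z] by simp
    then have "\<forall>w\<in>insert z Z. pref z w"
      using x pref_trans[of z x] refl[OF const_act, of z] by blast
    then show ?thesis by blast
  qed
qed

lemma worst_outcome:
  assumes "finite Z" "Z \<noteq> {}"
  shows "\<exists>x\<in>Z. \<forall>z\<in>Z. pref z x"
  using assms
proof (induction rule: finite_ne_induct)
  case (singleton z)
  then show ?case using refl[OF const_act, of z] by simp
next
  case (insert z Z)
  then obtain x where x: "x \<in> Z" "\<And>z. z \<in> Z \<Longrightarrow> pref z x"
    by blast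
  show ?case
  proof (cases "pref z x")
    case True
    then show ?thesis using x by auto
  next
    case False
    then have "pref x z"
      using total[OF const_act const_act, of x z] by simp
    then have "\<forall>w\<in>insert z Z. pref w z"
      using x pref_trans[of _ x z] refl[OF const_act, of z] by blast
    then show ?thesis by blast
  qed
qed

lemma spanning_interval:
  assumes "finite Z" and 0: "strict Q (\<lambda>_. x0) (\<lambda>_. y0)" "x0 \<in> Z" "y0 \<in> Z"
  obtains x y where "strict Q (\<lambda>_. x) (\<lambda>_. y)" "Z \<subseteq> between x y" "x \<in> Z" "y \<in> Z"
proof -
  have "Z \<noteq> {}"
    using 0 by blast
  then obtain x y where xy: "x \<in> Z" "y \<in> Z" "\<forall>z\<in>Z. pref x z" "\<forall>z\<in>Z. pref z y"
    using best_outcome[OF assms(1)] worst_outcome[OF assms(1)] by blast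
  then have "\<not> pref y x"
    using 0 xy(3,4) pref_trans[of x0 y x] pref_trans[of y0 y x] pref_trans[of y0 x x0]
    by (auto simp: strict_def)
  then show ?thesis
    using that[of x y] xy by (auto simp: strict_def between_def)
qed

text \<open>
  The utility of \<open>z\<close> is its value on a scale that spans \<open>x0\<close>, \<open>y0\<close> and \<open>z\<close>, normalised so that \<open>x0\<close>
  has utility \<open>1\<close> and \<open>y0\<close> has utility \<open>0\<close>. By \<open>cal_rescale\<close> every wider scale, in particular one that
  spans all outcomes of two given acts, is an affine transform of this utility.
\<close>

theorem expected_utility:
  obtains u where "\<And>f g. f \<in> acts Ev \<Longrightarrow> g \<in> acts Ev \<Longrightarrow> f \<succeq> g \<longleftrightarrow> exp_util u P g \<le> exp_util u P f"
proof -
  obtain x0 y0 where 0: "strict Q (\<lambda>_. x0) (\<lambda>_. y0)"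
    using nontrivial by blast
  have "\<exists>v. \<forall>X Y. strict Q (\<lambda>_. X) (\<lambda>_. Y) \<longrightarrow> {x0, y0, z} \<subseteq> between X Y \<longrightarrow>
      cal X Y z = (cal X Y x0 - cal X Y y0) * v + cal X Y y0" for z
  proof -
    obtain x y where xy: "strict Q (\<lambda>_. x) (\<lambda>_. y)" "{x0, y0, z} \<subseteq> between x y" "x \<in> {x0, y0, z}" "y \<in> {x0, y0, z}"
      by (rule spanning_interval[OF _ 0, of "{x0, y0, z}"]) simp_all
    let ?v = "(cal x y z - cal x y y0) / (cal x y x0 - cal x y y0)"
    have pos: "cal x y x0 - cal x y y0 > 0"
      using interval_utility[OF xy(1) const_act _ const_act, of y0 x0] xy(2) 0
      by (auto simp: strict_def exp_util_const)
    show ?thesis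
    proof (intro exI[of _ ?v] allI impI)
      fix X Y
      assume XY: "strict Q (\<lambda>_. X) (\<lambda>_. Y)" "{x0, y0, z} \<subseteq> between X Y"
      let ?K = "cal X Y x - cal X Y y"
      have "pref X x" "pref y Y"
        using XY(2) xy(3,4) by (auto simp: between_def)
      then have eqs: "cal X Y w = cal X Y y + cal x y w * ?K" if "w \<in> {x0, y0, z}" for w
        using cal_rescale[OF XY(1) xy(1)] xy(2) that by blast
      have "cal X Y x0 - cal X Y y0 = (cal x y x0 - cal x y y0) * ?K"
        using eqs[of x0] eqs[of y0] by (simp add: left_diff_distrib)
      moreover have "cal X Y z - cal X Y y0 = (cal x y z - cal x y y0) * ?K"
        using eqs[of z] eqs[of y0] by (simp add: left_diff_distrib)
      ultimately have "cal X Y z - cal X Y y0 = (cal X Y x0 - cal X Y y0) * ?v"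
        using pos by simp
      then show "cal X Y z = (cal X Y x0 - cal X Y y0) * ?v + cal X Y y0"
        by (simp only: diff_eq_eq)
    qed
  qed
  then obtain u where u: "\<And>z X Y. strict Q (\<lambda>_. X) (\<lambda>_. Y) \<Longrightarrow> {x0, y0, z} \<subseteq> between X Y \<Longrightarrow>
      cal X Y z = (cal X Y x0 - cal X Y y0) * u z + cal X Y y0"
    by metis
  show ?thesis
  proof (rule that[of u])
    fix f g :: "('s, 'o) act"
    assume f: "f \<in> acts Ev" and g: "g \<in> acts Ev"
    have "finite ({x0, y0} \<union> range f \<union> range g)"
      using f g by (simp add: acts_def)
    then obtain X Y where XY: "strict Q (\<lambda>_. X) (\<lambda>_. Y)" "{x0, y0} \<union> range f \<union> range g \<subseteq> between X Y"
      by (rule spanning_interval[OF _ 0]) simp_all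
    let ?a = "cal X Y x0 - cal X Y y0"
    have eu: "exp_util (cal X Y) P h = ?a * exp_util u P h + cal X Y y0"
      if "h \<in> acts Ev" "range h \<subseteq> between X Y" for h
    proof (rule exp_util_affine[OF that(1)])
      fix z
      assume "z \<in> range h"
      then have "{x0, y0, z} \<subseteq> between X Y"
        using XY(2) that(2) by blast
      then show "cal X Y z = ?a * u z + cal X Y y0"
        by (rule u[OF XY(1)])
    qed
    have "?a > 0"
      using interval_utility[OF XY(1) const_act _ const_act, of y0 x0] XY(2) 0
      by (auto simp: strict_def exp_util_const)
    then show "f \<succeq> g \<longleftrightarrow> exp_util u P g \<le> exp_util u P f"
      using interval_utility[OF XY(1) f _ g] eu[OF f] eu[OF g] XY(2) by simp
  qed
qed

end

theorem (in savage) expected_utility_exists: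
  "\<exists>u P. convex_probability Ev P \<and>
    (\<forall>f\<in>acts Ev. \<forall>g\<in>acts Ev. f \<succeq> g \<longleftrightarrow> exp_util u P g \<le> exp_util u P f)"
proof -
  obtain P where P: "convex_probability Ev P"
    "\<And>x y A B. strict Q (\<lambda>_. x) (\<lambda>_. y) \<Longrightarrow> A \<in> Ev \<Longrightarrow> B \<in> Ev \<Longrightarrow>
      bet x y A \<succeq> bet x y B \<longleftrightarrow> P B \<le> P A"
    using belief by blast
  interpret savage_belief Ev Q P
    by (rule savage_belief.intro[OF savage_axioms P(1) savage_belief_axioms.intro]) (rule P(2))
  obtain u where "\<And>f g. f \<in> acts Ev \<Longrightarrow> g \<in> acts Ev \<Longrightarrow> f \<succeq> g \<longleftrightarrow> exp_util u P g \<le> exp_util u P f"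
    using expected_utility by blast
  then show ?thesis
    using P(1) by blast
qed

section \<open>Uniqueness\<close>

context fa_probability
begin

lemma exp_util_bet_le_iff:
  assumes "A \<in> Ev" "B \<in> Ev" "u y < u x"
  shows "exp_util u P (paste (\<lambda>_. x) A (\<lambda>_. y)) \<le> exp_util u P (paste (\<lambda>_. x) B (\<lambda>_. y)) \<longleftrightarrow>
    P A \<le> P B"
proof -
  have "exp_util u P (paste (\<lambda>_. x) C (\<lambda>_. y)) = u y + (u x - u y) * P C" if "C \<in> Ev" for C
    by (simp add: exp_util_bet[OF that] algebra_simps)
  then show ?thesis
    using assms by simp
qed

end

text \<open>
  Both probabilities represent the bets on \<open>x\<close> against \<open>y\<close>, so \<open>P'\<close> is constant on events of equal
  \<open>P\<close> and hence equal to \<open>P\<close>. An outcome \<open>q\<close> between \<open>p\<close> and \<open>r\<close> is as good as a bet on \<open>p\<close> against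
  \<open>r\<close> whose winning probability both utilities determine in the same way. So the points
  \<open>(u z, u' z)\<close> are collinear.
\<close>

lemma expected_utility_unique:
  assumes "convex_probability Ev P" "convex_probability Ev P'"
    and rep: "\<And>f g. f \<in> acts Ev \<Longrightarrow> g \<in> acts Ev \<Longrightarrow> Q f g \<longleftrightarrow> exp_util u P g \<le> exp_util u P f"
    and rep': "\<And>f g. f \<in> acts Ev \<Longrightarrow> g \<in> acts Ev \<Longrightarrow> Q f g \<longleftrightarrow> exp_util u' P' g \<le> exp_util u' P' f"
    and xy: "strict Q (\<lambda>_. x) (\<lambda>_. y)"
  shows "\<And>A. A \<in> Ev \<Longrightarrow> P' A = P A" and "\<exists>a b. a > 0 \<and> (\<forall>z. u' z = a * u z + b)"
proof -
  interpret p: convex_probability Ev P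
    by fact
  interpret p': convex_probability Ev P'
    by fact
  note const = acts_const[OF p.sigma_algebra_axioms]
  have bet: "paste (\<lambda>_. p) A (\<lambda>_. q) \<in> acts Ev" if "A \<in> Ev" for A and p q :: 'b
    using that by (intro acts_paste[OF p.sigma_algebra_axioms] const)
  have "u y < u x"
    using xy by (simp add: strict_def rep[OF const const] p.exp_util_const)
  moreover have "u' y < u' x"
    using xy by (simp add: strict_def rep'[OF const const] p'.exp_util_const)
  ultimately have less: "u y < u x" "u' y < u' x" .
  have iff: "P A \<le> P B \<longleftrightarrow> P' A \<le> P' B" if "A \<in> Ev" "B \<in> Ev" for A B
    using rep[OF bet[OF that(2), of x y] bet[OF that(1), of x y]]
      rep'[OF bet[OF that(2), of x y] bet[OF that(1), of x y]]
      p.exp_util_bet_le_iff[where u = u and x = x and y = y, OF that less(1)]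
      p'.exp_util_bet_le_iff[where u = u' and x = x and y = y, OF that less(2)] by simp
  show P': "P' A = P A" if "A \<in> Ev" for A
  proof -
    have "P' A = P' UNIV * P A"
    proof (rule p.additive_function_linear[OF p'.nonneg p'.add _ that])
      show "P' B = P' C" if "B \<in> Ev" "C \<in> Ev" "P B = P C" for B C
        using iff[OF that(1,2)] iff[OF that(2,1)] that(3) by simp
    qed
    then show ?thesis
      using p'.UNIV_eq_1 by simp
  qed
  have line: "(u' q - u' r) * (u p - u r) = (u q - u r) * (u' p - u' r)"
    if le: "u r \<le> u q" "u q \<le> u p" "u r < u p" for p q r
  proof -
    let ?l = "(u q - u r) / (u p - u r)"
    have "0 \<le> ?l" "?l \<le> P UNIV"
      using le p.UNIV_eq_1 by simp_all
    then obtain A where A: "A \<in> Ev" "P A = ?l"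
      using p.subevent[of UNIV ?l] by auto
    let ?f = "paste (\<lambda>_. p) A (\<lambda>_. r)"
    have l: "P A * (u p - u r) = u q - u r"
      using A(2) le(3) by simp
    then have "exp_util u P ?f = exp_util u P (\<lambda>_. q)"
      by (simp add: p.exp_util_bet[OF A(1)] p.exp_util_const algebra_simps)
    then have "exp_util u' P' ?f = exp_util u' P' (\<lambda>_. q)"
      using rep[OF bet[OF A(1), of p r] const[of q]] rep'[OF bet[OF A(1), of p r] const[of q]]
        rep[OF const[of q] bet[OF A(1), of p r]] rep'[OF const[of q] bet[OF A(1), of p r]] by simp
    then have "u' q - u' r = P A * (u' p - u' r)"
      using P'[OF A(1)] by (simp add: p'.exp_util_bet[OF A(1)] p'.exp_util_const algebra_simps)
    then show ?thesis
      unfolding l[symmetric] by simp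
  qed
  let ?a = "(u' x - u' y) / (u x - u y)"
  have "u' z = ?a * u z + (u' y - ?a * u y)" for z
  proof -
    have "(u' z - u' y) * (u x - u y) = (u z - u y) * (u' x - u' y)"
    proof -
      consider "u y \<le> u z \<and> u z \<le> u x" | "u x < u z" | "u z < u y"
        by linarith
      then show ?thesis
      proof cases
        case 1
        then show ?thesis
          using line[of y z x] less by simp
      next
        case 2
        then show ?thesis
          using line[of y x z] less by (simp add: algebra_simps)
      next
        case 3
        then show ?thesis
          using line[of z y x] less by (simp add: algebra_simps)
      qed
    qed
    then have "u' z - u' y = ?a * (u z - u y)"
      using less by (simp add: nonzero_eq_divide_eq mult.commute)
    then show ?thesis
      by (simp add: right_diff_distrib)
  qed
  moreover have "?a > 0"
    using less by simp
  ultimately show "\<exists>a b. a > 0 \<and> (\<forall>z. u' z = a * u z + b)"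
    by blast
qed

section \<open>Conditional preferences\<close>

text \<open>
  The conditional axioms compare acts given \<open>E \<inter> B\<close>, while the postulates above compare pasted acts
  given \<open>E\<close>. The two facts \<open>cong\<close> (only the values on the conditioning event matter) and \<open>combine\<close>
  (a preference given \<open>E \<inter> B\<close> persists given \<open>E\<close> if the acts agree on the rest) translate between
  them.
\<close>

lemma conditional_preference_savage:
  fixes Ev :: "'s set set" and R :: "'s set \<Rightarrow> ('s, 'o) act \<Rightarrow> ('s, 'o) act \<Rightarrow> bool"
  assumes sa: "sigma_algebra UNIV Ev"
    and wo: "\<And>A. A \<in> Ev \<Longrightarrow> weak_order_on (acts Ev) (R A)"
    and P1: "P1half Ev R" and P2: "P2half Ev R" and P3: "P3half Ev R"
    and P4: "P4half Ev R" and P5: "P5half R" and P6: "P6half Ev R"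
    and E: "E \<in> Ev" "E \<noteq> {}"
  shows "savage Ev (R E)"
proof -
  interpret sigma_algebra UNIV Ev
    by fact
  note const = acts_const[OF sa] and paste = acts_paste[OF sa]
  have refl: "R A f f" if "A \<in> Ev" "f \<in> acts Ev" for A f
    using wo[OF that(1)] that(2) by (auto simp: weak_order_on_def)
  have total: "R A f g \<or> R A g f" if "A \<in> Ev" "f \<in> acts Ev" "g \<in> acts Ev" for A f g
    using wo[OF that(1)] that(2,3) by (auto simp: weak_order_on_def)
  have cong: "R A f g \<longleftrightarrow> R A f' g'"
    if A: "A \<in> Ev" and acts: "f \<in> acts Ev" "g \<in> acts Ev" "f' \<in> acts Ev" "g' \<in> acts Ev"
      and eq: "\<And>s. s \<in> A \<Longrightarrow> f s = f' s" "\<And>s. s \<in> A \<Longrightarrow> g s = g' s" for A f g f' g'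
  proof -
    have *: "R A h k \<longleftrightarrow> R A (paste h A f) (paste k A f)" if "h \<in> acts Ev" "k \<in> acts Ev" for h k
      using P1 A that acts(1) unfolding P1half_def by blast
    have "paste f A f = paste f' A f" "paste g A f = paste g' A f"
      using eq by (auto simp: paste_def)
    then show ?thesis
      using *[OF acts(1,2)] *[OF acts(3,4)] by simp
  qed
  have const_iff: "R A (\<lambda>_. x) (\<lambda>_. y) \<longleftrightarrow> R UNIV (\<lambda>_. x) (\<lambda>_. y)" if "A \<in> Ev" "A \<noteq> {}" for A x y
    using P3 that unfolding P3half_def by blast
  have combine: "R E (paste f B h) (paste g B h)"
    if B: "B \<in> Ev" and acts: "f \<in> acts Ev" "g \<in> acts Ev" "h \<in> acts Ev" and le: "R (E \<inter> B) f g"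
    for B f g h
  proof -
    have ev: "E \<inter> B \<in> Ev" "E - E \<inter> B \<in> Ev"
      using E B by auto
    have fg: "paste f B h \<in> acts Ev" "paste g B h \<in> acts Ev"
      using paste acts B by auto
    have "R (E \<inter> B) (paste f B h) (paste g B h)"
      using cong[OF ev(1) fg acts(1,2)] le by (simp add: paste_def)
    moreover have "R (E - E \<inter> B) (paste f B h) (paste g B h)"
      using cong[OF ev(2) fg acts(3,3)] refl[OF ev(2) acts(3)] by (simp add: paste_def)
    ultimately show ?thesis
      using P2 E ev(1) fg unfolding P2half_def by blast
  qed
  show ?thesis
  proof (intro savage.intro savage_axioms.intro sa wo E)
    fix B and f g h h' :: "('s, 'o) act"
    assume B: "B \<in> Ev" and acts: "f \<in> acts Ev" "g \<in> acts Ev" "h \<in> acts Ev" "h' \<in> acts Ev"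
      and le: "R E (paste f B h) (paste g B h)"
    have ev: "E \<inter> B \<in> Ev" "E - E \<inter> B \<in> Ev"
      using E B by auto
    have p: "paste f B h \<in> acts Ev" "paste g B h \<in> acts Ev" "paste f B h' \<in> acts Ev" "paste g B h' \<in> acts Ev"
      using paste acts B by auto
    show "R E (paste f B h') (paste g B h')"
    proof (cases "R (E \<inter> B) f g")
      case True
      then show ?thesis
        using combine[OF B acts(1,2,4)] by blast
    next
      case False
      then have "strict (R (E \<inter> B)) (paste g B h) (paste f B h)"
        using cong[OF ev(1) p(1,2) acts(1,2)] cong[OF ev(1) p(2,1) acts(2,1)] total[OF ev(1) acts(1,2)]
        by (simp add: strict_def paste_def)
      moreover have "R (E - E \<inter> B) (paste g B h) (paste f B h)"
        using cong[OF ev(2) p(2,1) acts(3,3)] refl[OF ev(2) acts(3)] by (simp add: paste_def)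
      ultimately have "\<not> null_at Ev R (E \<inter> B) E \<Longrightarrow> strict (R E) (paste g B h) (paste f B h)"
        using P2 E ev(1) p(1,2) unfolding P2half_def by blast
      then have "null_at Ev R (E \<inter> B) E"
        using le by (auto simp: strict_def)
      then have "R E (paste f B h') (paste g B h') \<longleftrightarrow> R (E - E \<inter> B) (paste f B h') (paste g B h')"
        using p(3,4) by (simp add: null_at_def agrees_def)
      then show ?thesis
        using cong[OF ev(2) p(3,4) acts(4,4)] refl[OF ev(2) acts(4)] by (simp add: paste_def)
    qed
  next
    fix B and h :: "('s, 'o) act" and x y
    assume B: "B \<in> Ev" and h: "h \<in> acts Ev" and le: "R E (\<lambda>_. x) (\<lambda>_. y)"
    have ev: "E \<inter> B \<in> Ev"
      using E B by auto
    have "R (E \<inter> B) (\<lambda>_. x) (\<lambda>_. y)"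
    proof (cases "E \<inter> B = {}")
      case True
      have "R (E \<inter> B) (\<lambda>_. x) (\<lambda>_. y) \<longleftrightarrow> R (E \<inter> B) (\<lambda>_. x) (\<lambda>_. x)"
        by (rule cong[OF ev const const const const]) (use True in auto)
      then show ?thesis
        using refl[OF ev const] by blast
    next
      case False
      then show ?thesis
        using const_iff[OF ev False, of x y] const_iff[OF E, of x y] le by simp
    qed
    then show "R E (paste (\<lambda>_. x) B h) (paste (\<lambda>_. y) B h)"
      by (rule combine[OF B const const h])
  next
    fix A B and x x' y y' :: 'o
    assume AB: "A \<in> Ev" "B \<in> Ev" and xx: "strict (R E) (\<lambda>_. x) (\<lambda>_. x')" and yy: "strict (R E) (\<lambda>_. y) (\<lambda>_. y')"
      and le: "R E (paste (\<lambda>_. x) A (\<lambda>_. x')) (paste (\<lambda>_. x) B (\<lambda>_. x'))"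
    have ev: "E \<inter> A \<in> Ev" "E \<inter> B \<in> Ev"
      using E AB by auto
    have bet: "paste (\<lambda>_. z) C (\<lambda>_. z') \<in> acts Ev" if "C \<in> Ev" for C and z z' :: 'o
      using that by (intro paste const)
    have eq: "R E (paste (\<lambda>_. z) A (\<lambda>_. z')) (paste (\<lambda>_. z) B (\<lambda>_. z')) \<longleftrightarrow>
        R E (paste (\<lambda>_. z) (E \<inter> A) (\<lambda>_. z')) (paste (\<lambda>_. z) (E \<inter> B) (\<lambda>_. z'))" for z z'
      by (rule cong[OF E(1) bet[OF AB(1)] bet[OF AB(2)] bet[OF ev(1)] bet[OF ev(2)]])
        (simp_all add: paste_def)
    have "strict (R UNIV) (\<lambda>_. x) (\<lambda>_. x')" "strict (R UNIV) (\<lambda>_. y) (\<lambda>_. y')"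
      using xx yy const_iff[OF E] by (auto simp: strict_def)
    then have "R E (paste (\<lambda>_. y) (E \<inter> A) (\<lambda>_. y')) (paste (\<lambda>_. y) (E \<inter> B) (\<lambda>_. y'))"
      using P4 E(1) ev le[unfolded eq] unfolding P4half_def by (meson Int_lower1)
    then show "R E (paste (\<lambda>_. y) A (\<lambda>_. y')) (paste (\<lambda>_. y) B (\<lambda>_. y'))"
      unfolding eq .
  next
    show "\<exists>x y. strict (R E) (\<lambda>_. x) (\<lambda>_. y)"
      using P5 const_iff[OF E] by (simp add: P5half_def strict_def)
  next
    fix f g :: "('s, 'o) act" and x
    assume acts: "f \<in> acts Ev" "g \<in> acts Ev" and fg: "strict (R E) f g"
    obtain \<P> where \<P>: "finite \<P>" "\<P> \<subseteq> Ev" "partition_on E \<P>"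
      "\<forall>C\<in>\<P>. strict (R E) f (paste (\<lambda>_. x) C g) \<and> strict (R E) (paste (\<lambda>_. x) C f) g"
      using P6 E acts fg unfolding P6half_def by metis
    \<comment> \<open>The complement of \<open>E\<close> completes the partition of \<open>E\<close> to a cover of the state space. Changing an
      act there has no effect on the preference given \<open>E\<close>.\<close>
    let ?N = "UNIV - E"
    have N: "?N \<in> Ev"
      using E by auto
    have p: "paste (\<lambda>_. x) ?N f \<in> acts Ev" "paste (\<lambda>_. x) ?N g \<in> acts Ev"
      by (intro paste const acts N)+
    have "strict (R E) f (paste (\<lambda>_. x) ?N g) \<and> strict (R E) (paste (\<lambda>_. x) ?N f) g"
      using fg cong[OF E(1) acts(1) p(2) acts] cong[OF E(1) p(2) acts(1) acts(2,1)]
        cong[OF E(1) p(1) acts(2) acts] cong[OF E(1) acts(2) p(1) acts(2,1)]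
      by (simp add: strict_def paste_def)
    then show "\<exists>\<P>. finite \<P> \<and> \<P> \<subseteq> Ev \<and> \<Union>\<P> = UNIV \<and>
        (\<forall>C\<in>\<P>. strict (R E) f (paste (\<lambda>_. x) C g) \<and> strict (R E) (paste (\<lambda>_. x) C f) g)"
      using \<P> N by (intro exI[of _ "insert ?N \<P>"]) (auto simp: partition_on_def)
  qed
qed

lemma eu_family_represents:
  assumes eu: "eu_family Ev R \<E> u P" and P0: "P0half Ev Q R \<E>"
  shows "represents Ev Q \<E> u P"
proof -
  have "strict (R E) f g \<longleftrightarrow> exp_util (u E) (P E) g < exp_util (u E) (P E) f"
    if "E \<in> \<E>" "f \<in> acts Ev" "g \<in> acts Ev" for E f g
    using eu that unfolding eu_family_def strict_def by (meson linorder_not_le less_imp_le)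
  then show ?thesis
    using P0 unfolding P0half_def represents_def by (simp cong: ball_cong bex_cong conj_cong)
qed

theorem theorem3:
  fixes Ev :: "'s set set"
    and Q :: "('s, 'o) act \<Rightarrow> ('s, 'o) act \<Rightarrow> bool"
    and R :: "'s set \<Rightarrow> ('s, 'o) act \<Rightarrow> ('s, 'o) act \<Rightarrow> bool"
    and \<E> :: "'s set set"
  assumes "infinite (UNIV :: 's set)"
    and "sigma_algebra UNIV Ev"
    and "weak_order_on (acts Ev) Q"
    and "\<And>A. A \<in> Ev \<Longrightarrow> weak_order_on (acts Ev) (R A)"
    and "P1half Ev R" and "P2half Ev R" and "P3half Ev R"
    and "P4half Ev R" and "P5half R" and "P6half Ev R"
    and "SE Ev R \<E>" and "P0half Ev Q R \<E>"
  shows "\<exists>(u :: 's set \<Rightarrow> 'o \<Rightarrow> real) (P :: 's set \<Rightarrow> 's set \<Rightarrow> real).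
    eu_family Ev R \<E> u P \<and>
    (\<forall>E\<in>\<E>. P E E = 1) \<and>
    represents Ev Q \<E> u P \<and>
    (\<forall>u' P'. eu_family Ev R \<E> u' P' \<and> represents Ev Q \<E> u' P' \<longleftrightarrow>
      (\<forall>E\<in>\<E>. (\<forall>A\<in>Ev. P' E A = P E A) \<and>
        (\<exists>a b. a > 0 \<and> (\<forall>x. u' E x = a * u E x + b))))"
proof -
  have sub: "E \<in> Ev" "E \<noteq> {}" if "E \<in> \<E>" for E
    using \<open>SE Ev R \<E>\<close> that by (auto simp: SE_def)
  have savage: "savage Ev (R E)" if "E \<in> \<E>" for E
    using conditional_preference_savage[OF assms(2,4-10) sub[OF that]] .
  have "\<forall>E. \<exists>u P. E \<in> \<E> \<longrightarrow> convex_probability Ev P \<and>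
      (\<forall>f\<in>acts Ev. \<forall>g\<in>acts Ev. R E f g \<longleftrightarrow> exp_util u P g \<le> exp_util u P f)"
    using savage.expected_utility_exists[OF savage] by blast
  then obtain u P where convex: "\<And>E. E \<in> \<E> \<Longrightarrow> convex_probability Ev (P E)"
    and rep: "\<And>E f g. E \<in> \<E> \<Longrightarrow> f \<in> acts Ev \<Longrightarrow> g \<in> acts Ev \<Longrightarrow>
      R E f g \<longleftrightarrow> exp_util (u E) (P E) g \<le> exp_util (u E) (P E) f"
    by metis
  have family_iff: "eu_family Ev R \<E> v M \<longleftrightarrow> (\<forall>E\<in>\<E>. convex_probability Ev (M E) \<and>
      (\<forall>f\<in>acts Ev. \<forall>g\<in>acts Ev. R E f g \<longleftrightarrow> exp_util (v E) (M E) g \<le> exp_util (v E) (M E) f))" for v M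
    using \<open>sigma_algebra UNIV Ev\<close>
    by (auto simp: eu_family_def convex_probability_def convex_probability_axioms_def
        fa_probability_def fa_probability_axioms_def)
  have eu: "eu_family Ev R \<E> u P"
    unfolding family_iff using convex rep by blast
  \<comment> \<open>Given \<open>E\<close>, the bet on \<open>E\<close> itself is as good as receiving the better outcome for sure.\<close>
  have full: "P E E = 1" if E: "E \<in> \<E>" for E
  proof -
    interpret convex_probability Ev "P E"
      by (rule convex[OF E])
    interpret savage Ev "R E"
      by (rule savage[OF E])
    obtain x y where xy: "strict (R E) (\<lambda>_. x) (\<lambda>_. y)"
      using nontrivial by blast
    then have less: "u E y < u E x"
      by (simp add: strict_def rep[OF E const_act const_act] exp_util_const)
    let ?b = "paste (\<lambda>_. x) E (\<lambda>_. y)"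
    have same: "paste ?b E ?b = ?b" "paste (\<lambda>_. x) E ?b = ?b"
      by (auto simp: paste_def fun_eq_iff)
    have b: "?b \<in> acts Ev"
      using sub(1)[OF E] by (intro paste_act const_act)
    have "R E ?b (\<lambda>_. x)"
    proof -
      have "R E (paste ?b E ?b) (paste (\<lambda>_. x) E ?b)"
        using refl[OF b] unfolding same .
      then show ?thesis
        using \<open>P1half Ev R\<close> sub(1)[OF E] b const_act unfolding P1half_def by blast
    qed
    then have "u E x \<le> u E x * P E E + u E y * (1 - P E E)"
      by (simp add: rep[OF E b const_act] exp_util_const exp_util_bet[OF sub(1)[OF E]])
    then have "0 \<le> (u E x - u E y) * (P E E - 1)"
      by (simp add: algebra_simps)
    then have "1 \<le> P E E"
      using less by (simp add: zero_le_mult_iff)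
    then show ?thesis
      using le_1[OF sub(1)[OF E]] by simp
  qed
  have unique: "(\<forall>A\<in>Ev. P' E A = P E A) \<and> (\<exists>a b. a > 0 \<and> (\<forall>x. u' E x = a * u E x + b))"
    if eu': "eu_family Ev R \<E> u' P'" and E: "E \<in> \<E>" for u' P' E
  proof -
    obtain x y where xy: "strict (R E) (\<lambda>_. x) (\<lambda>_. y)"
      using savage.nontrivial[OF savage[OF E]] by blast
    have c': "convex_probability Ev (P' E)" and rep': "\<And>f g. f \<in> acts Ev \<Longrightarrow> g \<in> acts Ev \<Longrightarrow>
        R E f g \<longleftrightarrow> exp_util (u' E) (P' E) g \<le> exp_util (u' E) (P' E) f"
      using eu' E unfolding family_iff by blast+
    show ?thesis
      using expected_utility_unique[OF convex[OF E] c' rep[OF E] rep' xy] by blast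
  qed
  have transform: "eu_family Ev R \<E> u' P'"
    if same: "\<forall>E\<in>\<E>. (\<forall>A\<in>Ev. P' E A = P E A) \<and> (\<exists>a b. a > 0 \<and> (\<forall>x. u' E x = a * u E x + b))" for u' P'
    unfolding eu_family_def
  proof (intro ballI conjI)
    fix E
    assume E: "E \<in> \<E>"
    interpret convex_probability Ev "P E"
      by (rule convex[OF E])
    have P': "\<And>A. A \<in> Ev \<Longrightarrow> P' E A = P E A"
      using same E by blast
    obtain a b where ab: "a > 0" "\<And>x. u' E x = a * u E x + b"
      using same E by blast
    show "fa_prob Ev (P' E)"
      using nonneg UNIV_eq_1 add P' P'[OF Un] by (auto simp: fa_prob_def additive_def)
    show "convex_valued Ev (P' E)"
      using convex P' unfolding convex_valued_def by metis
    have exp: "exp_util (u' E) (P' E) f = a * exp_util (u E) (P E) f + b" if f: "f \<in> acts Ev" for f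
    proof -
      have "exp_util (u' E) (P' E) f = exp_util (u' E) (P E) f"
        using f P' by (simp add: exp_util_def acts_def)
      also have "\<dots> = a * exp_util (u E) (P E) f + b"
        by (rule exp_util_affine[OF f]) (rule ab(2))
      finally show ?thesis .
    qed
    show "R E f g = (exp_util (u' E) (P' E) g \<le> exp_util (u' E) (P' E) f)"
      if "f \<in> acts Ev" "g \<in> acts Ev" for f g
      using rep[OF E that] exp that ab(1) by simp
  qed
  have represents: "represents Ev Q \<E> v M" if "eu_family Ev R \<E> v M" for v M
    by (rule eu_family_represents[OF that \<open>P0half Ev Q R \<E>\<close>])
  have "eu_family Ev R \<E> u' P' \<and> represents Ev Q \<E> u' P' \<longleftrightarrow>
      (\<forall>E\<in>\<E>. (\<forall>A\<in>Ev. P' E A = P E A) \<and> (\<exists>a b. a > 0 \<and> (\<forall>x. u' E x = a * u E x + b)))" for u' P'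
    using unique[of u' P'] transform[of P' u'] represents[of u' P'] by blast
  then show ?thesis
    using eu full represents[OF eu] by (intro exI[of _ u] exI[of _ P] conjI ballI allI) simp_all
qed

end
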